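(* Let $F:\mathbb{Z}^3\to\mathbb{Z}$ be either the quadratic form $F(x,y,z)=xy-z^2$ or the quadratic form $F(x,y,z)=x^2+y^2-z^2$. Then for every $\epsilon>0$ there exists a positive integer $k=k(\epsilon)$ such that for every set $B\subset\mathbb{Z}^3$ with $d^*(B)>\epsilon$ we have $$k\mathbb{Z}\subset F(B-B)=\{F(b_1-b_2)\;:\;b_1,b_2\in B\}.$$
   Context: For $B\subset\mathbb{Z}^d$, the upper Banach density is $d^*(B)=\lim_{L\to\infty}\max_{x\in\mathbb{Z}^d}\frac{|B\cap(x+[0,L)^d)|}{L^d}$. $B-B=\{b_1-b_2: b_1,b_2\in B\}$. *)

theory Defs
  imports "HOL-Analysis.Analysis"
begin

type_synonym z3 = "int \<times> int \<times> int"

definition cube :: "z3 \<Rightarrow> nat \<Rightarrow> z3 set" where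
  "cube x L = {(fst x + a, fst (snd x) + b, snd (snd x) + c) | a b c.
                 a \<in> {0..<int L} \<and> b \<in> {0..<int L} \<and> c \<in> {0..<int L}}"

definition upper_banach_density :: "z3 set \<Rightarrow> real" where
  "upper_banach_density B =
     lim (\<lambda>L::nat. (SUP x::z3. real (card (B \<inter> cube x L))) / real L ^ 3)"

definition vdiff :: "z3 \<Rightarrow> z3 \<Rightarrow> z3" where
  "vdiff u v = (fst u - fst v, fst (snd u) - fst (snd v), snd (snd u) - snd (snd v))"

definition diffset :: "z3 set \<Rightarrow> z3 set" where
  "diffset B = {vdiff b1 b2 | b1 b2. b1 \<in> B \<and> b2 \<in> B}"

end

theory Submission
  imports Defs
begin

text \<open>
  On a sublattice of finite index both forms become a multiple of \<open>xy - z\<^sup>2\<close>, and on the vectors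
  \<open>(q, q (t + s\<^sup>2), q s)\<close> this form equals \<open>q\<^sup>2 t\<close> whatever \<open>s\<close> is. By Cauchy--Schwarz some \<open>q\<close> bounded
  in terms of \<open>\<epsilon>\<close> is the first coordinate of many differences, say \<open>A = B \<inter> (B - q e\<^sub>1)\<close> is dense. It
  remains to show that for some \<open>N\<close> depending only on the density, and all \<open>t \<in> N\<int>\<close>, the set
  \<open>A\<close> meets its translate by \<open>q (0, t + s\<^sup>2, s)\<close> for some \<open>s\<close>.

  Let \<open>f\<close> be the normalised indicator function of \<open>A\<close> in a large cube, \<open>P\<^sub>i\<close> the average over a long
  progression of difference \<open>m\<^sub>i\<close> in the first of the two remaining coordinates, and \<open>R\<^sub>i\<close> the average
  of the translations by \<open>(t + m\<^sub>i\<^sup>2 s\<^sup>2, m\<^sub>i s)\<close> over a window of \<open>s\<close>. Split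
  \<open>f = P\<^sub>i f + (P\<^sub>i\<^sub>+\<^sub>1 f - P\<^sub>i f) + (f - P\<^sub>i\<^sub>+\<^sub>1 f)\<close>. The first part contributes a positive amount to
  \<open>\<langle>R\<^sub>i f, f\<rangle>\<close> because \<open>m\<^sub>i\<close> divides \<open>t\<close>; the third one is negligible by van der Corput's inequality
  because \<open>m\<^sub>i\<^sub>+\<^sub>1\<close> is a multiple of \<open>2 m\<^sub>i\<^sup>2 h\<close> for all small \<open>h\<close>; and the middle one is small for some
  \<open>i\<close> bounded in terms of the density, by almost orthogonality. So \<open>N\<close> can be taken to be the last
  of the \<open>m\<^sub>i\<close>.
\<close>

section \<open>Recurrence along squares for isometric actions\<close>

text \<open>A shift by one exchanges a single term at each end of the window, at a cost of at most
  \<open>2 * B\<close>; \<open>h\<close> such shifts add up.\<close>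

lemma norm_sum_shift_nat:
  fixes x :: "int \<Rightarrow> 'a::real_normed_vector"
  assumes "\<And>s. norm (x s) \<le> B" and "0 \<le> K"
  shows "norm ((\<Sum>s\<in>{-K..K}. x (s + int h)) - (\<Sum>s\<in>{-K..K}. x s)) \<le> 2 * real h * B"
proof (induction h)
  case 0
  then show ?case by simp
next
  case (Suc h)
  have shift: "(\<Sum>s\<in>{-K..K}. y (s + 1)) - (\<Sum>s\<in>{-K..K}. y s) = y (K + 1) - y (-K)"
    for y :: "int \<Rightarrow> 'a"
  proof -
    have "(\<Sum>s\<in>{-K..K}. y (s + 1)) = (\<Sum>s\<in>{-K+1..K+1}. y s)"
      by (rule sum.reindex_bij_witness[where i = "\<lambda>s. s - 1" and j = "\<lambda>s. s + 1"]) auto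
    moreover have "(\<Sum>s\<in>{-K..K+1}. y s) = y (-K) + (\<Sum>s\<in>{-K+1..K+1}. y s)"
      using assms(2) by (subst simp_from_to) auto
    moreover have "{-K..K+1} = insert (K+1) {-K..K}" using assms(2) by auto
    then have "(\<Sum>s\<in>{-K..K+1}. y s) = y (K+1) + (\<Sum>s\<in>{-K..K}. y s)" by simp
    ultimately show ?thesis by (simp add: algebra_simps)
  qed
  have "norm ((\<Sum>s\<in>{-K..K}. x (s + int (Suc h))) - (\<Sum>s\<in>{-K..K}. x (s + int h)))
      = norm (x (K + 1 + int h) - x (-K + int h))"
    using shift[of "\<lambda>s. x (s + int h)"] by (simp add: add_ac)
  also have "\<dots> \<le> B + B"
    using norm_triangle_ineq4 assms(1) by (meson add_mono order_trans)
  finally have "norm ((\<Sum>s\<in>{-K..K}. x (s + int (Suc h))) - (\<Sum>s\<in>{-K..K}. x (s + int h))) \<le> 2 * B"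
    by simp
  from norm_triangle_le[OF add_mono[OF this Suc.IH]]
  show ?case by (simp add: algebra_simps)
qed

lemma norm_sum_shift:
  fixes x :: "int \<Rightarrow> 'a::real_normed_vector"
  assumes "\<And>s. norm (x s) \<le> B" and "0 \<le> K"
  shows "norm ((\<Sum>s\<in>{-K..K}. x (s + h)) - (\<Sum>s\<in>{-K..K}. x s)) \<le> 2 * real_of_int \<bar>h\<bar> * B"
proof (cases "0 \<le> h")
  case True
  then show ?thesis using norm_sum_shift_nat[of x B K "nat h", OF assms] by simp
next
  case False
  have "norm ((\<Sum>s\<in>{-K..K}. x (s + int (nat (-h)) + h)) - (\<Sum>s\<in>{-K..K}. x (s + h)))
      \<le> 2 * real (nat (-h)) * B"
    by (rule norm_sum_shift_nat[of "\<lambda>s. x (s + h)" B K]) (use assms in auto)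
  with False show ?thesis by (simp add: norm_minus_commute)
qed

section \<open>Isometric actions of the integer plane and their averages\<close>

text \<open>The intended model is the action by translations on finitely supported functions on the
  lattice, along a homomorphism from the plane.\<close>

locale isometric_action =
  fixes T :: "int \<times> int \<Rightarrow> 'a::real_inner \<Rightarrow> 'a"
  assumes T_linear: "linear (T g)"
    and T_T: "T g (T h x) = T (g + h) x"
    and T_zero: "T 0 x = x"
    and inner_T_T: "inner (T g x) (T g y) = inner x y"
begin

lemma norm_T [simp]: "norm (T g x) = norm x"
  by (simp add: norm_eq_sqrt_inner inner_T_T)

lemma inner_T_left: "inner (T g x) y = inner x (T (- g) y)"
  using inner_T_T[of "- g" "T g x" y] by (simp add: T_T T_zero)

lemma T_diff: "T g (x - y) = T g x - T g y"
  by (simp add: T_linear linear_diff)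

definition Av :: "'i set \<Rightarrow> ('i \<Rightarrow> int \<times> int) \<Rightarrow> 'a \<Rightarrow> 'a" where
  "Av I w x = (\<Sum>i\<in>I. T (w i) x) /\<^sub>R real (card I)"

lemma linear_Av: "linear (Av I w)"
  unfolding Av_def
  by (intro linear_compose_scale_right linear_compose_sum ballI T_linear)

lemma Av_diff: "Av I w (x - y) = Av I w x - Av I w y"
  by (simp add: linear_Av linear_diff)

lemma norm_Av_le: "norm (Av I w x) \<le> norm x"
proof -
  have "norm (\<Sum>i\<in>I. T (w i) x) \<le> real (card I) * norm x"
    by (rule sum_norm_bound) simp
  then show ?thesis
    by (cases "card I = 0") (auto simp: Av_def field_simps)
qed

lemma Av_T: "Av I w (T g x) = T g (Av I w x)"
  by (simp add: Av_def linear_scale[OF T_linear] linear_sum[OF T_linear] T_T add.commute)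

text \<open>The acting group is abelian, so an average commutes with every \<open>T g\<close> and
  hence with every other average.\<close>

lemma Av_Av: "Av I w (Av J v x) = Av J v (Av I w x)"
proof -
  have "Av I w (Av J v x) = (\<Sum>j\<in>J. Av I w (T (v j) x)) /\<^sub>R real (card J)"
    by (simp add: Av_def[of J] linear_scale[OF linear_Av] linear_sum[OF linear_Av])
  also have "\<dots> = Av J v (Av I w x)"
    by (simp add: Av_T Av_def[of J])
  finally show ?thesis .
qed

lemma Av_near:
  assumes "finite I" "I \<noteq> {}" and "\<And>i. i \<in> I \<Longrightarrow> norm (T (w i) x - x) \<le> e"
  shows "norm (Av I w x - x) \<le> e"
proof -
  have c: "real (card I) > 0" using assms by (simp add: card_gt_0_iff)
  have "Av I w x - x = (\<Sum>i\<in>I. T (w i) x - x) /\<^sub>R real (card I)"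
    using c by (simp add: Av_def sum_subtractf scaleR_diff_right sum_constant_scaleR)
  moreover have "norm (\<Sum>i\<in>I. T (w i) x - x) \<le> real (card I) * e"
    by (rule sum_norm_bound) (use assms in auto)
  ultimately show ?thesis using c by (simp add: field_simps)
qed

text \<open>An approximate projection onto the vectors fixed by \<open>T (m, 0)\<close>. The window
  is symmetric so that the operator is self-adjoint.\<close>

definition M :: "int \<Rightarrow> int \<Rightarrow> 'a \<Rightarrow> 'a" where
  "M m K = Av {-K..K} (\<lambda>k. (m * k, 0))"

lemma M_self_adjoint: "inner (M m K x) y = inner x (M m K y)"
proof -
  have "(\<Sum>k\<in>{-K..K}. inner x (T (- (m * k, 0)) y)) = (\<Sum>k\<in>{-K..K}. inner x (T (m * k, 0) y))"
    by (rule sum.reindex_bij_witness[where i = "\<lambda>s. - s" and j = "\<lambda>s. - s"]) auto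
  then show ?thesis
    by (simp add: M_def Av_def inner_sum_left inner_sum_right inner_T_left)
qed

text \<open>Translating by \<open>(m * j, 0)\<close> shifts the window by \<open>j\<close>, so only
  boundary terms survive.\<close>

lemma M_invariant:
  assumes "0 \<le> K"
  shows "norm (T (m * j, 0) (M m K x) - M m K x) \<le> 2 * real_of_int \<bar>j\<bar> / (2 * real_of_int K + 1) * norm x"
proof -
  have "T (m * j, 0) (M m K x) - M m K x
      = ((\<Sum>k\<in>{-K..K}. T (m * (k + j), 0) x) - (\<Sum>k\<in>{-K..K}. T (m * k, 0) x)) /\<^sub>R real (card {-K..K})"
    by (simp add: M_def Av_def linear_scale[OF T_linear] linear_sum[OF T_linear] T_T
        scaleR_diff_right algebra_simps)
  moreover have "norm ((\<Sum>k\<in>{-K..K}. T (m * (k + j), 0) x) - (\<Sum>k\<in>{-K..K}. T (m * k, 0) x))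
      \<le> 2 * real_of_int \<bar>j\<bar> * norm x"
    by (rule norm_sum_shift[of "\<lambda>k. T (m * k, 0) x"]) (use assms in auto)
  ultimately have "norm (T (m * j, 0) (M m K x) - M m K x)
      \<le> (2 * real_of_int \<bar>j\<bar> * norm x) / (2 * real_of_int K + 1)"
    using assms by (simp add: divide_inverse mult.commute mult_left_mono)
  then show ?thesis by simp
qed

text \<open>Since \<open>m\<close> divides \<open>m'\<close>, every translation averaged in
  \<open>M m' K'\<close> moves by at most \<open>m' * K'\<close> steps of length \<open>m\<close>,
  and \<open>M m K x\<close> hardly notices these when \<open>K\<close> is much larger.\<close>

lemma M_near:
  assumes "0 \<le> K" "0 \<le> K'" "norm x \<le> 1" "m dvd m'" "0 < m" "0 < m'"
    and "2 * (real_of_int m' * real_of_int K') \<le> e * (2 * real_of_int K + 1)"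
  shows "norm (M m' K' (M m K x) - M m K x) \<le> e"
  unfolding M_def[of m' K']
proof (rule Av_near)
  fix k assume k: "k \<in> {-K'..K'}"
  from assms obtain q where q: "m' = m * q" by auto
  have q0: "0 < q" "q \<le> m'"
    using assms q by (auto simp: zero_less_mult_iff)
  have "\<bar>q * k\<bar> \<le> m' * K'"
    using k q0 by (simp add: abs_mult) (intro mult_mono, auto)
  then have qk: "real_of_int \<bar>q * k\<bar> \<le> real_of_int m' * real_of_int K'"
    by (metis of_int_le_iff of_int_mult)
  have "norm (T (m * (q * k), 0) (M m K x) - M m K x) \<le> 2 * real_of_int \<bar>q * k\<bar> / (2 * real_of_int K + 1) * norm x"
    by (rule M_invariant) (use assms in auto)
  also have "\<dots> \<le> 2 * real_of_int \<bar>q * k\<bar> / (2 * real_of_int K + 1) * 1"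
    by (rule mult_left_mono) (use assms in auto)
  also have "\<dots> \<le> 2 * (real_of_int m' * real_of_int K') / (2 * real_of_int K + 1)"
    using assms qk by (auto intro!: divide_right_mono)
  also have "\<dots> \<le> e"
    using assms by (simp add: field_simps)
  finally show "norm (T (m' * k, 0) (M m K x) - M m K x) \<le> e"
    by (simp add: q mult.assoc)
qed (use assms in auto)

section \<open>Van der Corput's inequality\<close>

text \<open>Shifting \<open>s\<close> by \<open>h\<close> and by \<open>h'\<close> gives two square
  displacements whose difference is linear in \<open>s\<close> with slope
  \<open>2 * N\<^sup>2 * (h - h')\<close> in the first coordinate and constant in the second. The
  correlations are therefore controlled by linear averages \<open>M\<close>.\<close>

lemma van_der_Corput:
  fixes t N W :: int and H :: nat
  assumes W: "0 \<le> W" and H: "0 < H" and G: "norm g \<le> G" "0 \<le> e"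
    and M: "\<And>d. 0 < d \<Longrightarrow> d < H \<Longrightarrow> norm (M (2 * N\<^sup>2 * int d) W g) \<le> e"
  shows "norm (Av {-W..W} (\<lambda>s. (t + N\<^sup>2 * s\<^sup>2, N * s)) g)
    \<le> sqrt (G\<^sup>2 / H + e * G) + 2 * real H * G / (2 * real_of_int W + 1)"
proof -
  define x where "x s = T (t + N\<^sup>2 * s\<^sup>2, N * s) g" for s
  define n where "n = 2 * real_of_int W + 1"
  have n: "real (card {-W..W}) = n" "n > 0" using W by (auto simp: n_def)
  define S where "S = (\<Sum>s\<in>{-W..W}. x s)"
  \<comment> \<open>Blocks of \<open>H\<close> consecutive terms: their sum over \<open>s\<close> is
    close to \<open>H\<close> times \<open>S\<close>, and their squared norms expand into the
    correlations of shifted terms.\<close>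
  define Y where "Y s = (\<Sum>h<H. x (s + int h))" for s
  have G0: "0 \<le> G" using G norm_ge_zero order_trans by blast
  have xG: "norm (x s) \<le> G" for s using G by (simp add: x_def)
  have off: "(\<Sum>s\<in>{-W..W}. inner (x (s + int h)) (x (s + int h'))) \<le> n * (e * G)"
    if "h' < h" "h < H" for h h'
  proof -
    define d where "d = h - h'"
    have d: "0 < d" "d < H" "int h = int h' + int d" using that by (auto simp: d_def)
    define c where "c = (N\<^sup>2 * int d * (int h + int h'), N * int d)"
    have "inner (x (s + int h)) (x (s + int h')) = inner (T (2 * N\<^sup>2 * int d * s, 0) g) (T (- c) g)" for s
    proof -
      have "inner (x (s + int h)) (x (s + int h'))
          = inner (T ((t + N\<^sup>2 * (s + int h)\<^sup>2, N * (s + int h)) - (t + N\<^sup>2 * (s + int h')\<^sup>2, N * (s + int h'))) g) g"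
        by (simp add: x_def inner_T_left T_T inner_commute)
      also have "(t + N\<^sup>2 * (s + int h)\<^sup>2, N * (s + int h)) - (t + N\<^sup>2 * (s + int h')\<^sup>2, N * (s + int h'))
          = c + (2 * N\<^sup>2 * int d * s, 0)"
        by (simp add: c_def d(3) power2_eq_square algebra_simps)
      also have "inner (T (c + (2 * N\<^sup>2 * int d * s, 0)) g) g = inner (T (2 * N\<^sup>2 * int d * s, 0) g) (T (- c) g)"
        by (simp add: inner_T_left[of c, symmetric] T_T)
      finally show ?thesis .
    qed
    then have "(\<Sum>s\<in>{-W..W}. inner (x (s + int h)) (x (s + int h')))
        = inner (\<Sum>s\<in>{-W..W}. T (2 * N\<^sup>2 * int d * s, 0) g) (T (- c) g)"
      by (simp add: inner_sum_left)
    also have "(\<Sum>s\<in>{-W..W}. T (2 * N\<^sup>2 * int d * s, 0) g) = n *\<^sub>R M (2 * N\<^sup>2 * int d) W g"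
      using n unfolding M_def Av_def by simp
    also have "inner (n *\<^sub>R M (2 * N\<^sup>2 * int d) W g) (T (- c) g)
        \<le> n * (norm (M (2 * N\<^sup>2 * int d) W g) * norm (T (- c) g))"
      using n norm_cauchy_schwarz[of "M (2 * N\<^sup>2 * int d) W g" "T (- c) g"] by simp
    also have "\<dots> \<le> n * (e * G)"
      using n M[OF d(1,2)] G by (auto intro!: mult_left_mono mult_mono)
    finally show ?thesis .
  qed
  have pair: "(\<Sum>s\<in>{-W..W}. inner (x (s + int h)) (x (s + int h')))
      \<le> (if h = h' then n * G\<^sup>2 else 0) + n * (e * G)" if "h < H" "h' < H" for h h'
  proof (cases h h' rule: linorder_cases)
    case equal
    have "(\<Sum>s\<in>{-W..W}. inner (x (s + int h)) (x (s + int h))) \<le> (\<Sum>s\<in>{-W..W}. G\<^sup>2)"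
      by (rule sum_mono) (use xG in \<open>auto simp: dot_square_norm intro: power_mono\<close>)
    also have "\<dots> = n * G\<^sup>2" using n by simp
    finally show ?thesis using equal n G G0 by (simp add: add_increasing2)
  next
    case less
    then show ?thesis using off[of h h'] that by (simp add: inner_commute)
  next
    case greater
    then show ?thesis using off[of h' h] that by simp
  qed
  have "(\<Sum>s\<in>{-W..W}. (norm (Y s))\<^sup>2)
      = (\<Sum>s\<in>{-W..W}. \<Sum>h<H. \<Sum>h'<H. inner (x (s + int h)) (x (s + int h')))"
    by (simp add: Y_def dot_square_norm[symmetric] inner_sum_left inner_sum_right)
      (rule sum.cong[OF refl], rule sum.swap)
  also have "\<dots> = (\<Sum>h<H. \<Sum>h'<H. \<Sum>s\<in>{-W..W}. inner (x (s + int h)) (x (s + int h')))"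
    by (subst sum.swap, rule sum.cong[OF refl], rule sum.swap)
  also have "\<dots> \<le> (\<Sum>h<H. \<Sum>h'<H. (if h = h' then n * G\<^sup>2 else 0) + n * (e * G))"
    by (intro sum_mono) (use pair in auto)
  also have "\<dots> = n * (H * G\<^sup>2 + H\<^sup>2 * (e * G))"
    by (simp add: sum.distrib power2_eq_square algebra_simps)
  finally have Y2: "(\<Sum>s\<in>{-W..W}. (norm (Y s))\<^sup>2) \<le> n * (H * G\<^sup>2 + H\<^sup>2 * (e * G))" .
  have "(norm (\<Sum>s\<in>{-W..W}. Y s))\<^sup>2 \<le> (\<Sum>s\<in>{-W..W}. norm (Y s))\<^sup>2"
    by (intro power_mono norm_sum) auto
  also have "\<dots> \<le> (\<Sum>s\<in>{-W..W}. (norm (Y s))\<^sup>2) * n"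
    using Cauchy_Schwarz_ineq_sum[of "\<lambda>s. norm (Y s)" "\<lambda>_. 1" "{-W..W}"] n by simp
  also have "\<dots> \<le> n * (H * G\<^sup>2 + H\<^sup>2 * (e * G)) * n"
    by (rule mult_right_mono[OF Y2]) (use n in simp)
  also have "\<dots> = (n * H)\<^sup>2 * (G\<^sup>2 / H + e * G)"
    using H by (simp add: power2_eq_square field_simps)
  finally have "norm (\<Sum>s\<in>{-W..W}. Y s) \<le> sqrt ((n * H)\<^sup>2 * (G\<^sup>2 / H + e * G))"
    by (rule real_le_rsqrt)
  also have "\<dots> = n * H * sqrt (G\<^sup>2 / H + e * G)"
    using n by (simp add: real_sqrt_mult)
  finally have Yn: "norm (\<Sum>s\<in>{-W..W}. Y s) \<le> n * H * sqrt (G\<^sup>2 / H + e * G)" .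
  \<comment> \<open>Replacing the blocks by \<open>H\<close> copies of \<open>S\<close> costs
    boundary terms for each shift \<open>h < H\<close>.\<close>
  have "(\<Sum>s\<in>{-W..W}. Y s) - real H *\<^sub>R S
      = (\<Sum>h<H. (\<Sum>s\<in>{-W..W}. x (s + int h)) - (\<Sum>s\<in>{-W..W}. x s))"
    unfolding Y_def S_def by (subst sum.swap) (simp add: sum_subtractf sum_constant_scaleR)
  also have "norm \<dots> \<le> (\<Sum>h<H. 2 * real H * G)"
  proof (rule sum_norm_le)
    fix h assume "h \<in> {..<H}"
    have "norm ((\<Sum>s\<in>{-W..W}. x (s + int h)) - (\<Sum>s\<in>{-W..W}. x s)) \<le> 2 * real h * G"
      by (rule norm_sum_shift_nat) (use xG W in auto)
    also have "\<dots> \<le> 2 * real H * G"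
      using \<open>h \<in> _\<close> G0 by (auto intro!: mult_right_mono)
    finally show "norm ((\<Sum>s\<in>{-W..W}. x (s + int h)) - (\<Sum>s\<in>{-W..W}. x s)) \<le> 2 * real H * G" .
  qed
  finally have "norm ((\<Sum>s\<in>{-W..W}. Y s) - real H *\<^sub>R S) \<le> H * (2 * H * G)" by simp
  moreover have "norm (real H *\<^sub>R S) \<le> norm (\<Sum>s\<in>{-W..W}. Y s) + norm ((\<Sum>s\<in>{-W..W}. Y s) - real H *\<^sub>R S)"
    using norm_triangle_ineq2[of "real H *\<^sub>R S" "\<Sum>s\<in>{-W..W}. Y s"] by (simp add: norm_minus_commute)
  ultimately have "H * norm S \<le> H * (n * sqrt (G\<^sup>2 / H + e * G) + 2 * H * G)"
    using Yn by (simp add: algebra_simps)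
  then have "norm S \<le> n * sqrt (G\<^sup>2 / H + e * G) + 2 * H * G"
    using H by simp
  then have "norm S / n \<le> (n * sqrt (G\<^sup>2 / H + e * G) + 2 * H * G) / n"
    by (rule divide_right_mono) (use n in simp)
  also have "\<dots> = sqrt (G\<^sup>2 / H + e * G) + 2 * real H * G / (2 * real_of_int W + 1)"
    using n(2) by (simp add: n_def[symmetric] add_divide_distrib)
  also have "norm S / n = norm (S /\<^sub>R n)"
    using n by (simp add: divide_inverse_commute)
  also have "S /\<^sub>R n = Av {-W..W} (\<lambda>s. (t + N\<^sup>2 * s\<^sup>2, N * s)) g"
    by (simp only: Av_def S_def x_def n)
  finally show ?thesis .
qed


section \<open>Recurrence along squares by almost orthogonality\<close>

text \<open>The assumptions from \<open>K_W\<close> to \<open>W_H\<close> say that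
  \<open>K i\<close> dwarfs \<open>W i\<close>, that \<open>W i\<close> dwarfs
  \<open>K (Suc i)\<close> and \<open>H\<close>, and that each \<open>K i\<close> dwarfs all later
  ones, also after multiplication by the moduli. If all correlations vanished, the middle parts for
  different \<open>i\<close> would all correlate negatively with \<open>f\<close>, which almost
  orthogonality forbids.\<close>

lemma recurrence:
  fixes m K W :: "nat \<Rightarrow> int" and H J :: nat and c e :: real and t :: int
  assumes c: "0 < c" "c \<le> 1" and e: "0 < e" "e \<le> c\<^sup>2 / 64"
    and H: "128 / c\<^sup>2 \<le> real H" and J: "64 / c\<^sup>2 < real J"
    and f: "norm f \<le> 1"
    and m_pos: "\<And>i. 0 < m i" and m_Suc: "\<And>i. m (Suc i) = 2 * (m i)\<^sup>2 * fact H"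
    and m_t: "\<And>i. i < 2 * J \<Longrightarrow> m i dvd t"
    and KW: "\<And>i. 0 \<le> K i" "\<And>i. 0 \<le> W i"
    and K_W: "\<And>i. i < 2 * J \<Longrightarrow>
      2 * (real_of_int \<bar>t\<bar> + (real_of_int (m i) * real_of_int (W i))\<^sup>2) \<le> e * (2 * real_of_int (K i) + 1)"
    and K_K: "\<And>i j. i < j \<Longrightarrow> j \<le> 2 * J \<Longrightarrow>
      2 * (real_of_int (m j) * real_of_int (K j)) \<le> e * (2 * real_of_int (K i) + 1)"
    and W_K: "\<And>i. i < 2 * J \<Longrightarrow>
      2 * (real_of_int (m (Suc i)) * real_of_int (K (Suc i))) \<le> e * (2 * real_of_int (W i) + 1)"
    and W_H: "\<And>i. i < 2 * J \<Longrightarrow> 4 * real H \<le> e * (2 * real_of_int (W i) + 1)"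
    and pos: "\<And>i. i < 2 * J \<Longrightarrow>
      c \<le> inner (Av {- W i..W i} (\<lambda>s. (0, m i * s)) (M (m i) (K i) f)) f"
  shows "\<exists>s. inner (T (t + s\<^sup>2, s) f) f \<noteq> 0"
proof (rule ccontr)
  assume "\<not> ?thesis"
  then have zero: "inner (T (t + s\<^sup>2, s) f) f = 0" for s by blast
  have m_dvd_Suc: "m i dvd m (Suc i)" for i
    by (simp add: m_Suc power2_eq_square)
  have m_dvd: "m i dvd m j" if "i \<le> j" for i j
    using that by (induction j) (auto simp: le_Suc_eq intro: dvd_trans m_dvd_Suc)
  define P where "P i = M (m i) (K i)" for i
  define R where "R i = Av {- W i..W i} (\<lambda>s. (t + (m i)\<^sup>2 * s\<^sup>2, m i * s))" for i
  define g where "g i = P (Suc i) f - P i f" for i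
  have P_le: "norm (P i x) \<le> norm x" and R_le: "norm (R i x) \<le> norm x" for i x
    by (simp_all add: P_def R_def M_def norm_Av_le)
  have P_diff: "P i (x - y) = P i x - P i y" and R_diff: "R i (x - y) = R i x - R i y" for i x y
    by (simp_all add: P_def R_def M_def Av_diff)
  have PR: "P i (R j x) = R j (P i x)" for i j x
    unfolding P_def R_def M_def by (rule Av_Av)
  have P_adj: "inner (P i x) y = inner x (P i y)" for i x y
    by (simp add: P_def M_self_adjoint)
  have P_P: "norm (P j (P i f) - P i f) \<le> e" if "i < j" "j \<le> 2 * J" for i j
    unfolding P_def
    by (rule M_near) (use that KW f m_dvd[of i j] m_pos K_K[OF that] in auto)

  \<comment> \<open>\<^term>\<open>P i f\<close> is almost invariant under the first coordinate, so on it \<^term>\<open>R i\<close> acts like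
    an average over the second coordinate only.\<close>
  have structured: "c - e \<le> inner (R i (P i f)) f" if i: "i < 2 * J" for i
  proof -
    define V where "V = Av {- W i..W i} (\<lambda>s. (0, m i * s)) (P i f)"
    have "norm (R i (P i f) - V) \<le> e"
    proof -
      have card: "real (card {- W i..W i}) > 0" using KW(2)[of i] by simp
      have "R i (P i f) - V = (\<Sum>s\<in>{- W i..W i}. T (0, m i * s) (T (t + (m i)\<^sup>2 * s\<^sup>2, 0) (P i f) - P i f))
          /\<^sub>R real (card {- W i..W i})"
        by (simp add: R_def V_def Av_def T_diff T_T sum_subtractf scaleR_diff_right)
      moreover have "norm (\<Sum>s\<in>{- W i..W i}. T (0, m i * s) (T (t + (m i)\<^sup>2 * s\<^sup>2, 0) (P i f) - P i f))
          \<le> real (card {- W i..W i}) * e"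
      proof (rule sum_norm_bound)
        fix s assume s: "s \<in> {- W i..W i}"
        \<comment> \<open>As \<open>m i\<close> divides \<open>t\<close>, the first displacement is
          a whole number \<open>j\<close> of steps of the progression averaged in
          \<open>P i\<close>.\<close>
        obtain q where q: "t = m i * q" using m_t[OF i] by auto
        define j where "j = q + m i * s\<^sup>2"
        have j: "t + (m i)\<^sup>2 * s\<^sup>2 = m i * j"
          by (simp add: j_def q power2_eq_square algebra_simps)
        have "\<bar>q\<bar> \<le> \<bar>t\<bar>"
          using mult_right_mono[of 1 "m i" "\<bar>q\<bar>"] m_pos[of i] by (simp add: q abs_mult)
        moreover have "m i * s\<^sup>2 \<le> (m i)\<^sup>2 * (W i)\<^sup>2"
          using m_pos[of i] s by (intro mult_mono) (auto simp: power2_eq_square intro: abs_le_square_iff[THEN iffD1, unfolded power2_eq_square])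
        moreover have "0 \<le> m i * s\<^sup>2" using m_pos[of i] by simp
        ultimately have "\<bar>j\<bar> \<le> \<bar>t\<bar> + (m i * W i)\<^sup>2"
          unfolding j_def by (simp add: power_mult_distrib)
        then have "real_of_int \<bar>j\<bar> \<le> real_of_int (\<bar>t\<bar> + (m i * W i)\<^sup>2)"
          by (simp only: of_int_le_iff)
        then have j': "2 * real_of_int \<bar>j\<bar> \<le> e * (2 * real_of_int (K i) + 1)"
          using K_W[OF i] by simp
        have "norm (T (m i * j, 0) (P i f) - P i f)
            \<le> 2 * real_of_int \<bar>j\<bar> / (2 * real_of_int (K i) + 1) * norm f"
          unfolding P_def by (rule M_invariant) (rule KW)
        also have "\<dots> \<le> 2 * real_of_int \<bar>j\<bar> / (2 * real_of_int (K i) + 1) * 1"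
          by (rule mult_left_mono) (use f KW(1)[of i] in auto)
        also have "\<dots> \<le> e"
          using j' KW(1)[of i] by (simp add: field_simps)
        finally show "norm (T (0, m i * s) (T (t + (m i)\<^sup>2 * s\<^sup>2, 0) (P i f) - P i f)) \<le> e"
          by (simp add: j)
      qed
      ultimately show ?thesis using card by (simp add: field_simps)
    qed
    then have "\<bar>inner (R i (P i f) - V) f\<bar> \<le> e * 1"
      using f e by (intro order_trans[OF Cauchy_Schwarz_ineq2] mult_mono) auto
    with pos[OF i] show ?thesis
      by (simp add: V_def P_def inner_diff_left)
  qed

  have random: "\<bar>inner (R i (f - P (Suc i) f)) f\<bar> \<le> c / 4 + e" if i: "i < 2 * J" for i
  proof -
    define y where "y = f - P (Suc i) f"
    have y: "norm y \<le> 2"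
      using norm_triangle_ineq4[of f "P (Suc i) f"] P_le[of "Suc i" f] f by (simp add: y_def)
    have H0: "0 < H"
    proof (rule ccontr)
      assume "\<not> ?thesis"
      moreover have "0 < 128 / c\<^sup>2" using c by simp
      ultimately show False using H by simp
    qed
    have "norm (R i y) \<le> sqrt (2\<^sup>2 / H + e * 2) + 2 * real H * 2 / (2 * real_of_int (W i) + 1)"
      unfolding R_def
    proof (rule van_der_Corput)
      fix d :: nat assume d: "0 < d" "d < H"
      define a where "a = 2 * (m i)\<^sup>2 * int d"
      \<comment> \<open>The factor \<open>fact H\<close> in \<open>m (Suc i)\<close> makes it a
        multiple of every slope \<open>a\<close> that van der Corput's inequality produces.\<close>
      have "int d dvd fact H"
        using d dvd_fact[of d H] by (metis less_imp_le of_nat_dvd_iff of_nat_fact Suc_leI One_nat_def)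
      then have adv: "a dvd m (Suc i)"
        unfolding a_def m_Suc by (rule mult_dvd_mono[OF dvd_refl])
      have a0: "0 < a" using d m_pos[of i] by (simp add: a_def)
      have "norm (P (Suc i) (M a (W i) f) - M a (W i) f) \<le> e"
        unfolding P_def by (rule M_near) (use KW f adv a0 m_pos W_K[OF i] in auto)
      \<comment> \<open>Because averages commute, \<open>M a (W i) y\<close> measures how far
        \<open>P (Suc i)\<close> is from fixing \<open>M a (W i) f\<close>.\<close>
      moreover have "M a (W i) y = M a (W i) f - P (Suc i) (M a (W i) f)"
        by (simp add: y_def P_def M_def Av_diff) (rule Av_Av)
      ultimately show "norm (M (2 * (m i)\<^sup>2 * int d) (W i) y) \<le> e"
        by (simp add: a_def norm_minus_commute)
    qed (use KW y H0 e in auto)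
    \<comment> \<open>The bounds on \<open>H\<close> and \<open>e\<close> make each of the two
      summands at most \<open>c\<^sup>2 / 32\<close>.\<close>
    also have "sqrt (2\<^sup>2 / H + e * 2) \<le> c / 4"
    proof (rule real_le_lsqrt)
      have "128 \<le> H * c\<^sup>2" using H c by (simp add: field_simps)
      then have "4 / H \<le> c\<^sup>2 / 32" using H0 by (simp add: field_simps)
      then show "2\<^sup>2 / H + e * 2 \<le> (c / 4)\<^sup>2"
        using e by (simp add: power_divide)
    qed (use c in auto)
    also have "2 * real H * 2 / (2 * real_of_int (W i) + 1) \<le> e"
      using W_H[OF i] KW(2)[of i] by (simp add: field_simps)
    finally have "norm (R i y) \<le> c / 4 + e" by simp
    then have "norm (R i y) * norm f \<le> (c / 4 + e) * 1"
      using f c e by (intro mult_mono) auto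
    then show ?thesis
      using Cauchy_Schwarz_ineq2[of "R i y" f] by (simp add: y_def)
  qed

  \<comment> \<open>All translates averaged in \<open>R i f\<close> are orthogonal to
    \<open>f\<close> by the assumption for contradiction, so the middle part must cancel the other
    two. The total is at most \<open>- 3 * c / 4 + 2 * e\<close>, where \<open>e\<close> is at most
    \<open>c / 64\<close>.\<close>
  have middle: "inner (R i (g i)) f \<le> - c / 2" if i: "i < 2 * J" for i
  proof -
    have "inner (R i f) f = 0"
      using zero[of "m i * _"] unfolding R_def Av_def
      by (simp add: inner_sum_left power_mult_distrib)
    moreover have "f = P i f + g i + (f - P (Suc i) f)" by (simp add: g_def)
    then have "R i f = R i (P i f) + R i (g i) + R i (f - P (Suc i) f)"
      by (simp add: g_def R_diff)
    ultimately have "inner (R i (g i)) f = - inner (R i (P i f)) f - inner (R i (f - P (Suc i) f)) f"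
      by (simp add: inner_add_left)
    also have "\<dots> \<le> - (c - e) + (c / 4 + e)"
      using structured[OF i] random[OF i] by linarith
    also have "\<dots> \<le> - c / 2"
    proof -
      have "c\<^sup>2 \<le> c" using c by (simp add: power2_eq_square mult_left_le)
      with e c show ?thesis by simp
    qed
    finally show ?thesis .
  qed

  \<comment> \<open>For \<open>j \<ge> i + 2\<close> both operators in \<open>P (j + 1) - P j\<close> almost fix \<^term>\<open>g i\<close>, so the vectors
    \<open>R i (g i)\<close> with \<open>i\<close> even are almost orthogonal; they cannot all have inner product at most
    \<open>- c / 2\<close> with \<^term>\<open>f\<close>.\<close>
  have g_le: "norm (g i) \<le> 2" for i
    using norm_triangle_ineq4[of "P (Suc i) f" "P i f"] P_le[of "Suc i" f] P_le[of i f] f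
    by (simp add: g_def)
  have off: "inner (R i (g i)) (R j (g j)) \<le> 4 * e" if ij: "Suc i < j" "j < 2 * J" for i j
  proof -
    have four: "norm (a - b - u + v) \<le> 4 * e"
      if "norm a \<le> e" "norm b \<le> e" "norm u \<le> e" "norm v \<le> e" for a b u v :: 'a
      using that norm_triangle_ineq4[of a b] norm_triangle_ineq4[of "a - b" u]
        norm_triangle_ineq[of "a - b - u" v] by linarith
    have eq: "P (Suc j) (g i) - P j (g i)
        = (P (Suc j) (P (Suc i) f) - P (Suc i) f) - (P (Suc j) (P i f) - P i f)
        - (P j (P (Suc i) f) - P (Suc i) f) + (P j (P i f) - P i f)"
      by (simp add: g_def P_diff)
    have "norm (P (Suc j) (g i) - P j (g i)) \<le> 4 * e"
      unfolding eq by (rule four; rule P_P) (use ij in auto)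
    then have "norm (R i (P (Suc j) (g i) - P j (g i))) \<le> 4 * e"
      using R_le order_trans by blast
    then have "norm (R i (P (Suc j) (g i) - P j (g i))) * norm (R j f) \<le> (4 * e) * 1"
      using e f R_le[of j f] by (intro mult_mono) auto
    \<comment> \<open>Self-adjointness and commutation move the difference
      \<open>P (Suc j) - P j\<close> from \<open>f\<close> over to \<open>g i\<close>.\<close>
    moreover have "inner (R i (g i)) (R j (g j)) = inner (R i (P (Suc j) (g i) - P j (g i))) (R j f)"
    proof -
      have "inner (R i (g i)) (R j (P l f)) = inner (R i (P l (g i))) (R j f)" for l
        using P_adj[of l "R i (g i)" "R j f"] by (simp add: PR)
      then show ?thesis
        by (simp add: g_def[of j] R_diff inner_diff_right inner_diff_left)
    qed
    ultimately show ?thesis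
      using norm_cauchy_schwarz[of "R i (P (Suc j) (g i) - P j (g i))" "R j f"] by simp
  qed
  define z where "z = (\<Sum>l<J. R (2 * l) (g (2 * l)))"
  have "(norm z)\<^sup>2 = (\<Sum>l<J. \<Sum>l'<J. inner (R (2 * l) (g (2 * l))) (R (2 * l') (g (2 * l'))))"
    by (simp add: z_def dot_square_norm[symmetric] inner_sum_left inner_sum_right)
      (rule sum.swap)
  also have "\<dots> \<le> (\<Sum>l<J. \<Sum>l'<J. (if l = l' then 4 else 0) + 4 * e)"
  proof (intro sum_mono)
    fix l l' assume l: "l \<in> {..<J}" "l' \<in> {..<J}"
    show "inner (R (2 * l) (g (2 * l))) (R (2 * l') (g (2 * l'))) \<le> (if l = l' then 4 else 0) + 4 * e"
    proof (cases l l' rule: linorder_cases)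
      case equal
      have "norm (R (2 * l) (g (2 * l))) \<le> 2" using R_le g_le order_trans by blast
      then have "(norm (R (2 * l) (g (2 * l))))\<^sup>2 \<le> 2\<^sup>2" by (intro power_mono) auto
      then show ?thesis using equal e by (simp add: dot_square_norm)
    next
      case less
      then show ?thesis using off[of "2 * l" "2 * l'"] l by simp
    next
      case greater
      then show ?thesis using off[of "2 * l'" "2 * l"] l by (simp add: inner_commute)
    qed
  qed
  also have "\<dots> = 4 * J + 4 * e * J\<^sup>2"
    by (simp add: sum.distrib power2_eq_square algebra_simps)
  finally have z_le: "(norm z)\<^sup>2 \<le> 4 * J + 4 * e * J\<^sup>2" .
  have "inner z f \<le> (\<Sum>l<J. - c / 2)"
    unfolding z_def inner_sum_left by (intro sum_mono middle) auto
  then have "J * (c / 2) \<le> inner (- z) f" by simp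
  also have "\<dots> \<le> norm (- z) * norm f" by (rule norm_cauchy_schwarz)
  also have "\<dots> \<le> norm z * 1" using mult_left_mono[OF f, of "norm z"] by simp
  finally have "(J * (c / 2))\<^sup>2 \<le> (norm z * 1)\<^sup>2"
    using c by (intro power_mono) auto
  \<comment> \<open>Since \<open>4 * e\<close> is at most \<open>c\<^sup>2 / 16\<close>, this leaves
    \<open>3 * J * c\<^sup>2\<close> at most 64, whereas \<open>J * c\<^sup>2\<close> exceeds
    64.\<close>
  with z_le have "J\<^sup>2 * c\<^sup>2 / 4 \<le> 4 * J + 4 * e * J\<^sup>2"
    by (simp add: power_mult_distrib power_divide)
  also have "4 * e * J\<^sup>2 \<le> c\<^sup>2 / 16 * J\<^sup>2"
    using e by (intro mult_right_mono) auto
  finally have "J * (J * c\<^sup>2) * 3 \<le> 64 * real J"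
    by (simp add: power2_eq_square algebra_simps)
  moreover have J0: "0 < real J"
    using J c by (smt (verit) divide_pos_pos zero_less_power)
  ultimately have "J * c\<^sup>2 * 3 \<le> 64" by simp
  moreover have "64 < J * c\<^sup>2" using J c by (simp add: field_simps)
  ultimately show False by simp
qed

end

text \<open>The order of quantifiers is the point: \<open>N\<close> depends on \<open>c\<close>
  alone, and \<open>R\<close> on \<open>c\<close> and \<open>t\<close>, but neither on the action or
  on \<open>f\<close>. Positivity is required only for parameters up to \<open>R\<close>, so a cube
  can be chosen large enough afterwards.\<close>

lemma uniform_recurrence:
  fixes c :: real
  assumes "0 < c"
  shows "\<exists>N>0. \<forall>t::int. N dvd t \<longrightarrow> (\<exists>R>0::int. \<forall>(T :: int \<times> int \<Rightarrow> 'a::real_inner \<Rightarrow> 'a) f.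
    isometric_action T \<longrightarrow> norm f \<le> 1 \<longrightarrow>
    (\<forall>m K W. 0 < m \<longrightarrow> m \<le> R \<longrightarrow> 0 \<le> K \<longrightarrow> K \<le> R \<longrightarrow> 0 \<le> W \<longrightarrow> W \<le> R \<longrightarrow>
      c \<le> inner (isometric_action.Av T {-W..W} (\<lambda>s. (0, m * s)) (isometric_action.M T m K f)) f) \<longrightarrow>
    (\<exists>s. inner (T (t + s\<^sup>2, s) f) f \<noteq> 0))"
proof -
  define c' where "c' = min c 1"
  have c': "0 < c'" "c' \<le> 1" "c' \<le> c" using assms by (auto simp: c'_def)
  define e where "e = c'\<^sup>2 / 64"
  have e0: "0 < e" using c' by (simp add: e_def)
  have e1: "e \<le> 1" using c' by (simp add: e_def power_le_one order_trans[of _ 1])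
  obtain H :: nat where H: "128 / c'\<^sup>2 \<le> real H" using real_arch_simple by blast
  obtain J :: nat where J: "64 / c'\<^sup>2 < real J" using reals_Archimedean2 by blast
  define m :: "nat \<Rightarrow> int" where "m = rec_nat 1 (\<lambda>_ a. 2 * a\<^sup>2 * fact H)"
  have m_0: "m 0 = 1" and m_Suc: "m (Suc i) = 2 * (m i)\<^sup>2 * fact H" for i
    by (simp_all add: m_def)
  have m_pos: "0 < m i" for i
    by (induction i) (auto simp: m_0 m_Suc)
  have m_dvd_Suc: "m i dvd m (Suc i)" for i
    by (simp add: m_Suc power2_eq_square)
  have m_dvd: "m i dvd m j" if "i \<le> j" for i j
    using that by (induction j) (auto simp: le_Suc_eq intro: dvd_trans m_dvd_Suc)
  define N where "N = m (2 * J)"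
  have N: "0 < N" by (simp add: N_def m_pos)
  have m_le: "m i \<le> N" "m i dvd N" if "i \<le> 2 * J" for i
    using m_dvd[OF that] m_pos zdvd_imp_le by (auto simp: N_def)
  show ?thesis
  proof (rule exI[of _ N], intro conjI allI impI)
    fix t :: int assume t: "N dvd t"
    \<comment> \<open>One factor \<open>X\<close> in the recursion below pays both for a modulus of
      size up to \<open>N\<close> and for the tolerance \<open>e\<close>.\<close>
    obtain X' :: nat where "N / e \<le> real X'" using real_arch_simple by blast
    define X where "X = int X'"
    have X: "real_of_int N \<le> e * X"
      using \<open>N / e \<le> real X'\<close> e0 by (simp add: X_def field_simps)
    have "real_of_int N \<le> X" 
      using X e1 by (smt (verit) X_def mult_left_le_one_le of_int_0_le_iff of_nat_0_le_iff e0)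
    then have X1: "1 \<le> X" using N by simp
    \<comment> \<open>The windows satisfy \<open>K i \<ggreater> W i \<ggreater> K (i + 1)\<close>, so they are built downwards from \<open>i = 2 J\<close>.\<close>
    define w where "w k = 4 * X * (k + int H)" for k
    define k where "k = rec_nat 1 (\<lambda>_ k. X * (\<bar>t\<bar> + (N * w k)\<^sup>2 + k))"
    have k_0: "k 0 = 1" and k_Suc: "k (Suc l) = X * (\<bar>t\<bar> + (N * w (k l))\<^sup>2 + k l)" for l
      by (simp_all add: k_def)
    have k_pos: "0 < k l" for l
      by (induction l) (use X1 in \<open>auto simp: k_0 k_Suc intro!: mult_pos_pos add_nonneg_pos\<close>)
    have w_pos: "0 \<le> w (k l)" for l
      using k_pos[of l] X1 by (simp add: w_def)
    have k_Suc_le: "k l \<le> k (Suc l)" for l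
    proof -
      have "1 * k l \<le> X * (\<bar>t\<bar> + (N * w (k l))\<^sup>2 + k l)"
        using X1 k_pos[of l] by (intro mult_mono) auto
      then show ?thesis by (simp add: k_Suc)
    qed
    have k_mono: "k l \<le> k l'" if "l \<le> l'" for l l'
      using that k_Suc_le by (rule lift_Suc_mono_le[rotated])
    define K where "K i = k (2 * J - i)" for i
    define W where "W i = w (k (2 * J - Suc i))" for i
    have K_rec: "K i = X * (\<bar>t\<bar> + (N * W i)\<^sup>2 + K (Suc i))" if "i < 2 * J" for i
      using that k_Suc[of "2 * J - Suc i"] by (simp add: K_def W_def Suc_diff_Suc)
    have W_rec: "W i = 4 * X * (K (Suc i) + int H)" for i
      by (simp add: W_def K_def w_def)
    have KW: "0 \<le> K i" "0 \<le> W i" for i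
      using k_pos w_pos by (auto simp: K_def W_def less_imp_le)
    have eX: "N * y \<le> e * real_of_int (X * x)" if "0 \<le> y" "y \<le> real_of_int x" for x :: int and y :: real
    proof -
      have "N * y \<le> (e * X) * x"
        using X N that by (intro mult_mono) auto
      then show ?thesis by simp
    qed
    have N1: "1 \<le> real_of_int N" using N by simp
    \<comment> \<open>A common bound for all the moduli and windows with index below
      \<open>2 * J\<close>.\<close>
    define R where "R = N + (\<Sum>i<2*J. K i + W i)"
    have "0 \<le> (\<Sum>i<2*J. K i + W i)" using KW by (intro sum_nonneg) auto
    then have R: "0 < R" "N \<le> R" using N by (auto simp: R_def)
    have KW_R: "K i \<le> R" "W i \<le> R" if "i < 2 * J" for i
    proof -
      have "K i + W i \<le> (\<Sum>i<2*J. K i + W i)"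
        by (rule member_le_sum) (use that KW in auto)
      then show "K i \<le> R" "W i \<le> R" using KW[of i] N by (auto simp: R_def)
    qed
    show "\<exists>R>0. \<forall>(T :: int \<times> int \<Rightarrow> 'a \<Rightarrow> 'a) f.
      isometric_action T \<longrightarrow> norm f \<le> 1 \<longrightarrow>
      (\<forall>m K W. 0 < m \<longrightarrow> m \<le> R \<longrightarrow> 0 \<le> K \<longrightarrow> K \<le> R \<longrightarrow> 0 \<le> W \<longrightarrow> W \<le> R \<longrightarrow>
        c \<le> inner (isometric_action.Av T {-W..W} (\<lambda>s. (0, m * s)) (isometric_action.M T m K f)) f) \<longrightarrow>
      (\<exists>s. inner (T (t + s\<^sup>2, s) f) f \<noteq> 0)"
    proof (rule exI[of _ R], intro conjI allI impI)
      fix T :: "int \<times> int \<Rightarrow> 'a \<Rightarrow> 'a" and f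
      assume T: "isometric_action T" and f: "norm f \<le> 1"
        and pos: "\<forall>m K W. 0 < m \<longrightarrow> m \<le> R \<longrightarrow> 0 \<le> K \<longrightarrow> K \<le> R \<longrightarrow> 0 \<le> W \<longrightarrow> W \<le> R \<longrightarrow>
        c \<le> inner (isometric_action.Av T {-W..W} (\<lambda>s. (0, m * s)) (isometric_action.M T m K f)) f"
      show "\<exists>s. inner (T (t + s\<^sup>2, s) f) f \<noteq> 0"
      proof (rule isometric_action.recurrence[where m = m and K = K and W = W, OF T c'(1,2) e0 _ H J f m_pos m_Suc _ KW])
        fix i assume i: "i < 2 * J"
        have mi: "m i \<le> N" "m (Suc i) \<le> N" using m_le i by auto
        show "m i dvd t" using m_le(2)[of i] i t dvd_trans by auto
        have "(m i * W i)\<^sup>2 \<le> (N * W i)\<^sup>2"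
          using mi m_pos[of i] KW by (intro power_mono mult_right_mono mult_nonneg_nonneg) auto
        then have "\<bar>t\<bar> + (m i * W i)\<^sup>2 \<le> \<bar>t\<bar> + (N * W i)\<^sup>2 + K (Suc i)"
          using KW(1)[of "Suc i"] by simp
        then have "real_of_int (\<bar>t\<bar> + (m i * W i)\<^sup>2) \<le> real_of_int (\<bar>t\<bar> + (N * W i)\<^sup>2 + K (Suc i))"
          by (simp only: of_int_le_iff)
        then have "N * real_of_int (\<bar>t\<bar> + (m i * W i)\<^sup>2) \<le> e * K i"
          unfolding K_rec[OF i] by (intro eX) auto
        moreover have "1 * real_of_int (\<bar>t\<bar> + (m i * W i)\<^sup>2) \<le> N * real_of_int (\<bar>t\<bar> + (m i * W i)\<^sup>2)"
          by (rule mult_right_mono[OF N1]) auto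
        ultimately show "2 * (real_of_int \<bar>t\<bar> + (real_of_int (m i) * real_of_int (W i))\<^sup>2)
            \<le> e * (2 * real_of_int (K i) + 1)"
          using e0 by (simp add: algebra_simps)
        have W: "N * real_of_int (4 * (K (Suc i) + int H)) \<le> e * W i"
        proof -
          have "N * real_of_int (4 * (K (Suc i) + int H)) \<le> e * real_of_int (X * (4 * (K (Suc i) + int H)))"
            using KW(1)[of "Suc i"] by (intro eX) auto
          then show ?thesis by (simp add: W_rec algebra_simps)
        qed
        have "real_of_int (m (Suc i)) * K (Suc i) \<le> N * real_of_int (4 * (K (Suc i) + int H))"
          using mi KW(1)[of "Suc i"] N by (intro mult_mono) auto
        then show "2 * (real_of_int (m (Suc i)) * real_of_int (K (Suc i))) \<le> e * (2 * real_of_int (W i) + 1)"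
          using W e0 by (simp add: algebra_simps)
        have "1 * (2 * real H) \<le> N * real_of_int (4 * (K (Suc i) + int H))"
          using N1 KW(1)[of "Suc i"] by (intro mult_mono) auto
        then show "4 * real H \<le> e * (2 * real_of_int (W i) + 1)"
          using W e0 by (simp add: algebra_simps)
        have "c \<le> inner (isometric_action.Av T {- W i..W i} (\<lambda>s. (0, m i * s)) (isometric_action.M T (m i) (K i) f)) f"
          using pos m_pos[of i] mi R KW[of i] KW_R[OF i] by (auto intro: order_trans)
        then show "c' \<le> inner (isometric_action.Av T {- W i..W i} (\<lambda>s. (0, m i * s)) (isometric_action.M T (m i) (K i) f)) f"
          using c' by simp
      next
        fix i j assume ij: "i < j" "j \<le> 2 * J"
        have "K j \<le> K (Suc i)" unfolding K_def using ij by (intro k_mono) auto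
        then have "K j \<le> \<bar>t\<bar> + (N * W i)\<^sup>2 + K (Suc i)"
          by (simp add: add_increasing)
        then have "real_of_int (K j) \<le> real_of_int (\<bar>t\<bar> + (N * W i)\<^sup>2 + K (Suc i))"
          by (simp only: of_int_le_iff)
        then have "N * real_of_int (K j) \<le> e * real_of_int (K i)"
          using ij KW(1)[of j] unfolding K_rec[of i, OF less_le_trans[OF ij]] by (intro eX) auto
        moreover have "m j * real_of_int (K j) \<le> N * real_of_int (K j)"
          using m_le(1)[OF ij(2)] KW(1)[of j] by (intro mult_right_mono) auto
        ultimately show "2 * (real_of_int (m j) * real_of_int (K j)) \<le> e * (2 * real_of_int (K i) + 1)"
          using e0 by (simp add: algebra_simps)
      qed (simp add: e_def)
    qed (rule R)
  qed (rule N)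
qed

section \<open>Finitely supported functions\<close>

text \<open>A subspace of square-summable functions that is stable under translation and contains
  indicators of finite sets. All averages in the recurrence argument are finite, so they stay inside
  it.\<close>

typedef 'b fsupp = "{f :: 'b \<Rightarrow> real. finite {x. f x \<noteq> 0}}" morphisms fsval Fsupp
  by (rule exI[of _ "\<lambda>_. 0"]) simp

setup_lifting type_definition_fsupp

lemma finite_fsval: "finite {x. fsval f x \<noteq> 0}"
  using fsval[of f] by simp

lemma fsupp_eqI: "(\<And>x. fsval f x = fsval g x) \<Longrightarrow> f = g"
  by (simp add: fsval_inject[symmetric] fun_eq_iff)

instantiation fsupp :: (type) real_inner
begin

lift_definition zero_fsupp :: "'a fsupp" is "\<lambda>_. 0" by simp

lift_definition plus_fsupp :: "'a fsupp \<Rightarrow> 'a fsupp \<Rightarrow> 'a fsupp" is "\<lambda>f g x. f x + g x"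
  by (erule (1) finite_subset[OF _ finite_UnI, rotated]) auto

lift_definition minus_fsupp :: "'a fsupp \<Rightarrow> 'a fsupp \<Rightarrow> 'a fsupp" is "\<lambda>f g x. f x - g x"
  by (erule (1) finite_subset[OF _ finite_UnI, rotated]) auto

lift_definition uminus_fsupp :: "'a fsupp \<Rightarrow> 'a fsupp" is "\<lambda>f x. - f x" by simp

lift_definition scaleR_fsupp :: "real \<Rightarrow> 'a fsupp \<Rightarrow> 'a fsupp" is "\<lambda>r f x. r * f x"
  by (erule finite_subset[rotated]) auto

definition inner_fsupp :: "'a fsupp \<Rightarrow> 'a fsupp \<Rightarrow> real" where
  "inner_fsupp f g = (\<Sum>x | fsval f x \<noteq> 0. fsval f x * fsval g x)"

definition norm_fsupp :: "'a fsupp \<Rightarrow> real" where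
  "norm_fsupp f = sqrt (inner f f)"

definition sgn_fsupp :: "'a fsupp \<Rightarrow> 'a fsupp" where
  "sgn_fsupp f = scaleR (inverse (norm f)) f"

definition dist_fsupp :: "'a fsupp \<Rightarrow> 'a fsupp \<Rightarrow> real" where
  "dist_fsupp f g = norm (f - g)"

definition uniformity_fsupp :: "('a fsupp \<times> 'a fsupp) filter" where
  "uniformity_fsupp = (INF e\<in>{0<..}. principal {(x, y). dist x y < e})"

definition open_fsupp :: "'a fsupp set \<Rightarrow> bool" where
  "open_fsupp U \<longleftrightarrow> (\<forall>x\<in>U. \<forall>\<^sub>F (x', y) in uniformity. x' = x \<longrightarrow> y \<in> U)"

text \<open>Lets inner products of functions with different supports be computed over one common
  finite set.\<close>

lemma inner_fsupp_superset:
  assumes "finite S" "{x. fsval f x \<noteq> 0} \<subseteq> S"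
  shows "inner f g = (\<Sum>x\<in>S. fsval f x * fsval g x)"
  unfolding inner_fsupp_def by (rule sum.mono_neutral_left) (use assms in auto)

instance
proof
  fix f g h :: "'a fsupp" and r s :: real
  show "f + g + h = f + (g + h)" "f + g = g + f" "0 + f = f" "- f + f = 0" "f - g = f + - g"
    "r *\<^sub>R (f + g) = r *\<^sub>R f + r *\<^sub>R g" "(r + s) *\<^sub>R f = r *\<^sub>R f + s *\<^sub>R f"
    "r *\<^sub>R s *\<^sub>R f = (r * s) *\<^sub>R f" "1 *\<^sub>R f = f"
    by (transfer; simp add: fun_eq_iff algebra_simps)+
  show "dist f g = norm (f - g)" "sgn f = scaleR (inverse (norm f)) f" "norm f = sqrt (inner f f)"
    by (simp_all add: dist_fsupp_def sgn_fsupp_def norm_fsupp_def)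
  show "(uniformity :: ('a fsupp \<times> 'a fsupp) filter) = (INF e\<in>{0<..}. principal {(x, y). dist x y < e})"
    by (rule uniformity_fsupp_def)
  show "open U \<longleftrightarrow> (\<forall>x\<in>U. \<forall>\<^sub>F (x', y) in uniformity. x' = x \<longrightarrow> y \<in> U)" for U :: "'a fsupp set"
    by (rule open_fsupp_def)
  let ?S = "{x. fsval f x \<noteq> 0} \<union> {x. fsval g x \<noteq> 0}"
  have S: "finite ?S" by (simp add: finite_fsval)
  have "inner f g = (\<Sum>x\<in>?S. fsval f x * fsval g x)" "inner g f = (\<Sum>x\<in>?S. fsval g x * fsval f x)"
    by (rule inner_fsupp_superset[OF S]; blast)+
  then show "inner f g = inner g f" by (simp add: mult.commute)
  have "inner (f + g) h = (\<Sum>x\<in>?S. fsval (f + g) x * fsval h x)"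
    by (rule inner_fsupp_superset[OF S]) (auto simp: plus_fsupp.rep_eq)
  moreover have "inner f h = (\<Sum>x\<in>?S. fsval f x * fsval h x)" "inner g h = (\<Sum>x\<in>?S. fsval g x * fsval h x)"
    by (rule inner_fsupp_superset[OF S]; blast)+
  ultimately show "inner (f + g) h = inner f h + inner g h"
    by (simp add: plus_fsupp.rep_eq distrib_right sum.distrib)
  have "inner (r *\<^sub>R f) g = (\<Sum>x | fsval f x \<noteq> 0. fsval (r *\<^sub>R f) x * fsval g x)"
    by (rule inner_fsupp_superset[OF finite_fsval]) (auto simp: scaleR_fsupp.rep_eq)
  then show "inner (r *\<^sub>R f) g = r * inner f g"
    by (simp add: inner_fsupp_def scaleR_fsupp.rep_eq sum_distrib_left mult.assoc)
  show "0 \<le> inner f f"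
    unfolding inner_fsupp_def by (rule sum_nonneg) simp
  show "inner f f = 0 \<longleftrightarrow> f = 0"
  proof
    assume "inner f f = 0"
    then have "\<forall>x\<in>{x. fsval f x \<noteq> 0}. fsval f x * fsval f x = 0"
      unfolding inner_fsupp_def by (subst (asm) sum_nonneg_eq_0_iff) (auto simp: finite_fsval)
    then show "f = 0" by (intro fsupp_eqI) (auto simp: zero_fsupp.rep_eq)
  next
    assume "f = 0"
    then show "inner f f = 0" by (simp add: inner_fsupp_def zero_fsupp.rep_eq)
  qed
qed

end

section \<open>Translations, indicators and return sets\<close>

lift_definition translate :: "'b::ab_group_add \<Rightarrow> 'b fsupp \<Rightarrow> 'b fsupp" is "\<lambda>v f x. f (x + v)"
proof -
  fix v :: 'b and f :: "'b \<Rightarrow> real"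
  assume "finite {x. f x \<noteq> 0}"
  then show "finite {x. f (x + v) \<noteq> 0}"
    by (rule finite_subset[rotated, OF finite_imageI[of _ "\<lambda>x. x - v"]]) (force simp: image_iff)
qed

lemma inner_translate_translate: "inner (translate v f) (translate v g) = inner f g"
  unfolding inner_fsupp_def translate.rep_eq
  by (rule sum.reindex_bij_witness[where i = "\<lambda>x. x - v" and j = "\<lambda>x. x + v"]) auto

lemma isometric_action_translate:
  assumes "\<And>g h. \<phi> (g + h) = \<phi> g + \<phi> h"
  shows "isometric_action (\<lambda>g. translate (\<phi> g))"
proof
  fix g h and f f' :: "'a fsupp" and r :: real
  have "\<phi> 0 = 0" using assms[of 0 0] by simp
  then show "translate (\<phi> 0) f = f"
    by (intro fsupp_eqI) (simp add: translate.rep_eq)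
  show "translate (\<phi> g) (translate (\<phi> h) f) = translate (\<phi> (g + h)) f"
    by (intro fsupp_eqI) (simp add: translate.rep_eq assms add.assoc)
  show "translate (\<phi> g) (f + f') = translate (\<phi> g) f + translate (\<phi> g) f'"
    "translate (\<phi> g) (r *\<^sub>R f) = r *\<^sub>R translate (\<phi> g) f"
    by (intro fsupp_eqI; simp add: translate.rep_eq plus_fsupp.rep_eq scaleR_fsupp.rep_eq)+
qed (rule inner_translate_translate)

text \<open>For infinite \<open>A\<close> the value is the zero function, which keeps the support
  finite.\<close>

lift_definition ind :: "'b set \<Rightarrow> 'b fsupp" is "\<lambda>A x. if finite A \<and> x \<in> A then 1 else 0"
  by (rule finite_subset[of _ "if finite A then A else {}" for A]) (auto split: if_splits)

definition returns :: "'b::ab_group_add set \<Rightarrow> 'b \<Rightarrow> 'b set" where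
  "returns A v = {x \<in> A. x + v \<in> A}"

text \<open>The bridge from analysis to combinatorics: a nonzero correlation exhibits
  \<open>v\<close> as a difference of two elements of \<open>A\<close>.\<close>

lemma inner_translate_ind:
  assumes "finite A"
  shows "inner (translate v (ind A)) (ind A) = real (card (returns A v))"
proof -
  have "inner (translate v (ind A)) (ind A) = inner (ind A) (translate v (ind A))"
    by (rule inner_commute)
  also have "\<dots> = (\<Sum>x\<in>A. fsval (ind A) x * fsval (translate v (ind A)) x)"
    by (rule inner_fsupp_superset) (use assms in \<open>auto simp: ind.rep_eq\<close>)
  also have "\<dots> = (\<Sum>x\<in>A. if x + v \<in> A then 1 else 0)"
    using assms by (intro sum.cong) (auto simp: ind.rep_eq translate.rep_eq)
  also have "\<dots> = real (card (returns A v))"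
    using assms by (simp add: sum.If_cases returns_def Int_def)
  finally show ?thesis .
qed

lemma card_returns_uminus: "card (returns A (- v)) = card (returns A v)"
  by (rule bij_betw_same_card[of "\<lambda>x. x - v"], rule bij_betw_byWitness[where f' = "\<lambda>x. x + v"])
    (auto simp: returns_def)

text \<open>Cauchy--Schwarz for the function counting how many translates \<open>A + w i\<close>
  contain a point of \<open>S\<close>. Its sum is \<open>card I * card A\<close>, and its second
  moment counts pairwise intersections.\<close>

lemma card_returns_sum_ge:
  fixes A :: "'b::ab_group_add set"
  assumes "finite I" "finite A" "finite S" and S: "\<And>i a. i \<in> I \<Longrightarrow> a \<in> A \<Longrightarrow> a + w i \<in> S"
  shows "(real (card I) * real (card A))\<^sup>2
    \<le> real (card S) * (\<Sum>i\<in>I. \<Sum>j\<in>I. real (card (returns A (w i - w j))))"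
proof -
  define ch where "ch i s = (if s - w i \<in> A then 1::real else 0)" for i s
  have one: "(\<Sum>s\<in>S. ch i s) = real (card A)" if "i \<in> I" for i
  proof -
    have "(\<Sum>s\<in>S. ch i s) = real (card {s \<in> S. s - w i \<in> A})"
      using assms by (simp add: ch_def sum.If_cases Int_def)
    also have "card {s \<in> S. s - w i \<in> A} = card A"
      by (rule bij_betw_same_card[of "\<lambda>s. s - w i"], rule bij_betw_byWitness[where f' = "\<lambda>x. x + w i"])
        (use S that in auto)
    finally show ?thesis .
  qed
  have two: "(\<Sum>s\<in>S. ch i s * ch j s) = real (card (returns A (w i - w j)))" if "i \<in> I" for i j
  proof -
    have "(\<Sum>s\<in>S. ch i s * ch j s) = (\<Sum>s\<in>S. if s - w i \<in> A \<and> s - w j \<in> A then 1 else 0)"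
      by (intro sum.cong) (auto simp: ch_def)
    also have "\<dots> = real (card {s \<in> S. s - w i \<in> A \<and> s - w j \<in> A})"
      using assms by (simp add: sum.If_cases Int_def)
    also have "card {s \<in> S. s - w i \<in> A \<and> s - w j \<in> A} = card (returns A (w i - w j))"
      by (rule bij_betw_same_card[of "\<lambda>s. s - w i"], rule bij_betw_byWitness[where f' = "\<lambda>x. x + w i"])
        (use S that in \<open>auto simp: returns_def algebra_simps\<close>)
    finally show ?thesis .
  qed
  have "real (card I) * real (card A) = (\<Sum>i\<in>I. \<Sum>s\<in>S. ch i s)"
    using one by simp
  also have "\<dots> = (\<Sum>s\<in>S. (\<Sum>i\<in>I. ch i s) * 1)"
    by (subst sum.swap) simp
  also have "\<dots>\<^sup>2 \<le> (\<Sum>s\<in>S. (\<Sum>i\<in>I. ch i s)\<^sup>2) * (\<Sum>s\<in>S. 1\<^sup>2)"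
    by (rule Cauchy_Schwarz_ineq_sum)
  also have "(\<Sum>s\<in>S. (\<Sum>i\<in>I. ch i s)\<^sup>2) = (\<Sum>s\<in>S. \<Sum>i\<in>I. \<Sum>j\<in>I. ch i s * ch j s)"
    by (simp add: power2_eq_square sum_product)
  also have "\<dots> = (\<Sum>i\<in>I. \<Sum>j\<in>I. \<Sum>s\<in>S. ch i s * ch j s)"
    by (subst sum.swap, rule sum.cong[OF refl], rule sum.swap)
  also have "\<dots> = (\<Sum>i\<in>I. \<Sum>j\<in>I. real (card (returns A (w i - w j))))"
    using two by simp
  finally show ?thesis by (simp add: mult.commute)
qed

text \<open>Apply the preceding inequality to the box \<open>I\<close> of nonnegative parameters.
  Differences of its points lie in the symmetric window, each arising at most once for a fixed
  second point; the window has at most four times as many points as \<open>I\<close>, whence the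
  factor 4.\<close>

lemma average_translate_ind_ge:
  fixes \<phi> :: "int \<times> int \<Rightarrow> 'b::ab_group_add"
  assumes \<phi>: "\<And>g h. \<phi> (g + h) = \<phi> g + \<phi> h"
    and fin: "finite A" "finite S" "S \<noteq> {}" and d: "0 \<le> d" and KW: "0 \<le> K" "0 \<le> W"
    and S: "\<And>k s a. 0 \<le> k \<Longrightarrow> k \<le> K \<Longrightarrow> 0 \<le> s \<Longrightarrow> s \<le> W \<Longrightarrow> a \<in> A \<Longrightarrow> a + \<phi> (m * k, m * s) \<in> S"
    and A: "d * real (card S) \<le> real (card A) * (real (card A))"
  shows "d / 4 \<le> inner (isometric_action.Av (\<lambda>g. translate (\<phi> g)) {-W..W} (\<lambda>s. (0, m * s))
    (isometric_action.M (\<lambda>g. translate (\<phi> g)) m K (ind A))) (ind A)"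
proof -
  interpret isometric_action "\<lambda>g. translate (\<phi> g)"
    by (rule isometric_action_translate) (rule \<phi>)
  define g where "g v = real (card (returns A (\<phi> (m * fst v, m * snd v))))" for v
  define G where "G = (\<Sum>v\<in>{-K..K} \<times> {-W..W}. g v)"
  define I where "I = {0..K} \<times> {0..W}"
  define w where "w v = \<phi> (m * fst v, m * snd v)" for v
  have cI: "real (card I) = (real_of_int K + 1) * (real_of_int W + 1)" "finite I"
    using KW by (auto simp: I_def)
  have cI0: "0 < real (card I)" using KW by (simp add: cI)
  have \<phi>_diff: "\<phi> (u - v) = \<phi> u - \<phi> v" for u v
    using \<phi>[of "u - v" v] by (simp add: algebra_simps)
  have wg: "real (card (returns A (w i - w j))) = g (i - j)" for i j
    by (simp add: g_def w_def \<phi>_diff[symmetric] right_diff_distrib)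
  have "(\<Sum>i\<in>I. g (i - j)) \<le> G" if "j \<in> I" for j
  proof -
    have "(\<Sum>i\<in>I. g (i - j)) = (\<Sum>v\<in>(\<lambda>i. i - j) ` I. g v)"
      by (subst sum.reindex) (auto simp: inj_on_def)
    also have "\<dots> \<le> G"
      unfolding G_def by (rule sum_mono2) (use that in \<open>auto simp: I_def g_def\<close>)
    finally show ?thesis .
  qed
  then have "(\<Sum>j\<in>I. \<Sum>i\<in>I. g (i - j)) \<le> (\<Sum>j\<in>I. G)"
    by (rule sum_mono)
  then have G_le: "(\<Sum>i\<in>I. \<Sum>j\<in>I. g (i - j)) \<le> real (card I) * G"
    by (subst sum.swap) simp
  have cS: "0 < real (card S)" using fin by (simp add: card_gt_0_iff)
  have "(real (card I) * real (card A))\<^sup>2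
      \<le> real (card S) * (\<Sum>i\<in>I. \<Sum>j\<in>I. real (card (returns A (w i - w j))))"
    by (rule card_returns_sum_ge) (use S fin cI in \<open>auto simp: I_def w_def\<close>)
  also have "\<dots> \<le> real (card S) * (real (card I) * G)"
    using G_le by (simp add: wg mult_left_mono)
  finally have "real (card I) * (real (card I) * (real (card A) * real (card A)))
      \<le> real (card I) * (real (card S) * G)"
    by (simp add: power2_eq_square algebra_simps)
  then have "real (card I) * (real (card A) * real (card A)) \<le> real (card S) * G"
    using cI0 by simp
  moreover have "real (card I) * (d * real (card S)) \<le> real (card I) * (real (card A) * real (card A))"
    by (rule mult_left_mono[OF A]) simp
  ultimately have "real (card S) * (real (card I) * d) \<le> real (card S) * G"
    by (simp add: mult_ac)
  then have Id: "real (card I) * d \<le> G" using cS by simp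
  define n where "n = (2 * real_of_int K + 1) * (2 * real_of_int W + 1)"
  have n: "0 < n" "n \<le> 4 * real (card I)"
    using KW by (simp add: n_def) (use KW in \<open>simp add: n_def cI algebra_simps\<close>)
  have "d / 4 * n \<le> d / 4 * (4 * real (card I))"
    using n d by (intro mult_left_mono) auto
  also have "\<dots> \<le> G" using Id by (simp add: mult.commute)
  finally have "d / 4 \<le> G / n" using n by (simp add: field_simps)
  also have "G = (\<Sum>s\<in>{-W..W}. \<Sum>k\<in>{-K..K}. g (k, s))"
    unfolding G_def sum.cartesian_product' by (rule sum.swap)
  also have "\<dots> / n = inner (Av {-W..W} (\<lambda>s. (0, m * s)) (M m K (ind A))) (ind A)"
    using KW by (simp add: M_def Av_def linear_scale[OF T_linear] linear_sum[OF T_linear] T_T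
        inner_sum_left inner_translate_ind fin g_def n_def scaleR_sum_right[symmetric] sum_divide_distrib[symmetric]
        sum_distrib_left[symmetric] divide_simps)
  finally show ?thesis .
qed

section \<open>Upper Banach density\<close>

lemma mem_cube:
  "(x, y, z) \<in> cube (a, b, c) L \<longleftrightarrow>
    a \<le> x \<and> x < a + int L \<and> b \<le> y \<and> y < b + int L \<and> c \<le> z \<and> z < c + int L"
proof
  assume "a \<le> x \<and> x < a + int L \<and> b \<le> y \<and> y < b + int L \<and> c \<le> z \<and> z < c + int L"
  then show "(x, y, z) \<in> cube (a, b, c) L"
    unfolding cube_def
    by (intro CollectI exI[of _ "x - a"] exI[of _ "y - b"] exI[of _ "z - c"]) auto
qed (auto simp: cube_def)

lemma cube_eq_Times: "cube (a, b, c) L = {a..<a + int L} \<times> {b..<b + int L} \<times> {c..<c + int L}"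
  by (auto simp: mem_cube)

lemma finite_cube [simp]: "finite (cube x L)"
  by (cases x) (simp add: cube_eq_Times)

lemma card_cube: "card (cube x L) = L ^ 3"
  by (cases x) (simp add: cube_eq_Times power3_eq_cube)

definition max_count :: "z3 set \<Rightarrow> nat \<Rightarrow> real" where
  "max_count B L = (SUP x::z3. real (card (B \<inter> cube x L)))"

lemma card_Int_cube_le: "card (B \<inter> cube x L) \<le> L ^ 3"
  by (metis card_cube card_mono finite_cube inf_le2)

lemma bdd_above_count: "bdd_above (range (\<lambda>x. real (card (B \<inter> cube x L))))"
  by (rule bdd_aboveI[of _ "real (L ^ 3)"]) (use card_Int_cube_le in \<open>auto simp del: of_nat_power\<close>)

lemma count_le_max_count: "real (card (B \<inter> cube x L)) \<le> max_count B L"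
  unfolding max_count_def by (rule cSUP_upper[OF UNIV_I bdd_above_count])

lemma max_count_nonneg: "0 \<le> max_count B L"
  using count_le_max_count[of B 0 L] by linarith

text \<open>Along each axis the small cube is found by integer division. The index
  \<open>L div m\<close> is included because the last cube may stick out.\<close>

lemma cube_covered:
  assumes "0 < m"
  shows "cube (a, b, c) L \<subseteq>
    (\<Union>(i, j, k)\<in>{0..L div m} \<times> {0..L div m} \<times> {0..L div m}.
      cube (a + int (m * i), b + int (m * j), c + int (m * k)) m)"
proof
  fix v assume v: "v \<in> cube (a, b, c) L"
  obtain x y z where xyz: "v = (x, y, z)" by (cases v)
  have 1: "\<exists>i\<in>{0..L div m}. a' + int (m * i) \<le> x' \<and> x' < a' + int (m * i) + int m"
    if "a' \<le> x'" "x' < a' + int L" for a' x' :: int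
  proof (rule bexI[of _ "nat (x' - a') div m"])
    have "int (nat (x' - a')) = int (m * (nat (x' - a') div m)) + int (nat (x' - a') mod m)"
      by (metis mult_div_mod_eq of_nat_add)
    moreover have "nat (x' - a') mod m < m" using assms by simp
    ultimately show "a' + int (m * (nat (x' - a') div m)) \<le> x' \<and>
        x' < a' + int (m * (nat (x' - a') div m)) + int m"
      using that by linarith
    show "nat (x' - a') div m \<in> {0..L div m}"
      using that by (auto intro: div_le_mono)
  qed
  from v xyz have "a \<le> x" "x < a + int L" "b \<le> y" "y < b + int L" "c \<le> z" "z < c + int L"
    by (auto simp: mem_cube)
  with 1 obtain i j k where "i \<in> {0..L div m}" "j \<in> {0..L div m}" "k \<in> {0..L div m}"
    "a + int (m * i) \<le> x \<and> x < a + int (m * i) + int m"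
    "b + int (m * j) \<le> y \<and> y < b + int (m * j) + int m"
    "c + int (m * k) \<le> z \<and> z < c + int (m * k) + int m"
    by meson
  then show "v \<in> (\<Union>(i, j, k)\<in>{0..L div m} \<times> {0..L div m} \<times> {0..L div m}.
      cube (a + int (m * i), b + int (m * j), c + int (m * k)) m)"
    by (intro UN_I[of "(i, j, k)"]) (auto simp: xyz mem_cube)
qed

lemma max_count_le:
  assumes "0 < m"
  shows "max_count B L \<le> (real L / real m + 1) ^ 3 * max_count B m"
  unfolding max_count_def[of B L]
proof (rule cSUP_least)
  fix x :: z3
  obtain a b c where x: "x = (a, b, c)" by (cases x)
  define I where "I = {0..L div m} \<times> {0..L div m} \<times> {0..L div m}"
  define f where "f = (\<lambda>(i, j, k). (a + int (m * i), b + int (m * j), c + int (m * k)))"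
  have cov: "cube x L \<subseteq> (\<Union>v\<in>I. cube (f v) m)"
    using cube_covered[OF assms, of a b c L] by (auto simp: x I_def f_def split_def)
  have "card (B \<inter> cube x L) \<le> card (\<Union>v\<in>I. B \<inter> cube (f v) m)"
    by (rule card_mono) (use cov in \<open>auto simp: I_def\<close>)
  also have "\<dots> \<le> (\<Sum>v\<in>I. card (B \<inter> cube (f v) m))"
    by (rule card_UN_le) (simp add: I_def)
  finally have "real (card (B \<inter> cube x L)) \<le> real (\<Sum>v\<in>I. card (B \<inter> cube (f v) m))"
    by (simp only: of_nat_le_iff)
  also have "\<dots> \<le> (\<Sum>v\<in>I. max_count B m)"
    unfolding of_nat_sum by (intro sum_mono count_le_max_count)
  also have "\<dots> = (real (L div m) + 1) ^ 3 * max_count B m"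
    by (simp add: I_def power3_eq_cube algebra_simps)
  also have "\<dots> \<le> (real L / real m + 1) ^ 3 * max_count B m"
    by (intro mult_right_mono power_mono add_right_mono max_count_nonneg of_nat_div_le_of_nat) auto
  finally show "real (card (B \<inter> cube x L)) \<le> (real L / real m + 1) ^ 3 * max_count B m" .
qed simp

text \<open>As in Fekete's lemma, covering large cubes by small ones shows that the ratios converge
  to their infimum over positive sides. This identifies the value of \<open>lim\<close> in the
  definition and bounds it by every single ratio.\<close>

lemma upper_banach_density_le:
  assumes "0 < m"
  shows "upper_banach_density B \<le> max_count B m / real m ^ 3"
proof -
  define r where "r L = max_count B L / real L ^ 3" for L
  define a where "a = (INF m\<in>{0<..}. r m)"
  have bdd: "bdd_below (r ` {0<..})"
    by (rule bdd_belowI[of _ 0]) (auto simp: r_def max_count_nonneg)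
  have a_le: "a \<le> r m" if "0 < m" for m
    unfolding a_def by (rule cINF_lower[OF bdd]) (use that in auto)
  have "r \<longlonglongrightarrow> a"
  proof (rule order_tendstoI)
    fix y assume "y < a"
    then show "eventually (\<lambda>L. y < r L) sequentially"
      using a_le by (intro eventually_sequentiallyI[of 1]) (meson less_le_trans less_le_not_le zero_less_one order_trans less_eq_Suc_le One_nat_def)
  next
    fix y assume "a < y"
    then obtain m where m: "0 < m" "r m < y"
      unfolding a_def using bdd by (subst (asm) cINF_less_iff) auto
    have "(\<lambda>L. (1 + real m / real L) ^ 3 * r m) \<longlonglongrightarrow> (1 + 0) ^ 3 * r m"
      by (intro tendsto_intros lim_const_over_n)
    then have "eventually (\<lambda>L. (1 + real m / real L) ^ 3 * r m < y) sequentially"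
      using m by (intro order_tendstoD(2)) auto
    then show "eventually (\<lambda>L. r L < y) sequentially"
      using eventually_gt_at_top[of 0]
    proof eventually_elim
      case (elim L)
      have "r L \<le> ((real L / real m + 1) ^ 3 * max_count B m) / real L ^ 3"
        unfolding r_def by (intro divide_right_mono max_count_le m) simp
      also have "\<dots> = ((real L / real m + 1) * real m / real L) ^ 3 * r m"
        using m by (simp add: r_def power_mult_distrib power_divide)
      also have "(real L / real m + 1) * real m / real L = 1 + real m / real L"
        using m elim by (simp add: field_simps)
      finally show ?case using elim by simp
    qed
  qed
  then have "upper_banach_density B = a"
    unfolding upper_banach_density_def max_count_def[symmetric] r_def[symmetric, abs_def] by (rule limI)
  then show ?thesis using a_le[OF assms] by (simp add: r_def)
qed

text \<open>Works for every side \<open>L\<close>, so the side can be fixed after all other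
  parameters.\<close>

lemma dense_cube:
  assumes "\<epsilon> < upper_banach_density B" "0 < L"
  obtains x where "\<epsilon> * real L ^ 3 < real (card (B \<inter> cube x L))"
proof -
  have "\<epsilon> < max_count B L / real L ^ 3"
    using assms upper_banach_density_le[of L B] by linarith
  then have "\<epsilon> * real L ^ 3 < max_count B L"
    using assms by (simp add: field_simps)
  then show ?thesis
    unfolding max_count_def using that
    by (subst (asm) less_cSUP_iff[OF _ bdd_above_count]) auto
qed

section \<open>Differences of dense sets\<close>

definition zsmul :: "int \<Rightarrow> z3 \<Rightarrow> z3" where
  "zsmul c v = (c * fst v, c * fst (snd v), c * snd (snd v))"

definition bounded_by :: "int \<Rightarrow> z3 \<Rightarrow> bool" where
  "bounded_by D v \<longleftrightarrow> \<bar>fst v\<bar> \<le> D \<and> \<bar>fst (snd v)\<bar> \<le> D \<and> \<bar>snd (snd v)\<bar> \<le> D"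

lemma zsmul_add: "zsmul (a + b) v = zsmul a v + zsmul b v"
  by (simp add: zsmul_def algebra_simps)

lemma zsmul_diff: "zsmul (a - b) v = zsmul a v - zsmul b v"
  by (simp add: zsmul_def algebra_simps)

lemma bounded_by_zsmul:
  assumes "bounded_by P v" "\<bar>c\<bar> \<le> C"
  shows "bounded_by (C * P) (zsmul c v)"
  using assms by (auto simp: bounded_by_def zsmul_def abs_mult intro!: mult_mono)

lemma bounded_by_add:
  assumes "bounded_by P v" "bounded_by Q w"
  shows "bounded_by (P + Q) (v + w)"
  using assms unfolding bounded_by_def fst_add snd_add by linarith

text \<open>Enlarging the cube by \<open>D\<close> on every side stays within doubled side length,
  so the volume grows only by a factor 8.\<close>

lemma add_mem_cube:
  assumes "v \<in> cube x L" "bounded_by D w" "2 * D \<le> int L" "0 \<le> D"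
  shows "v + w \<in> cube (x - (D, D, D)) (2 * L)"
  using assms by (cases v; cases x; cases w) (auto simp: mem_cube bounded_by_def)

text \<open>If all these return sets were small, the \<open>Q\<close> translates of \<open>A\<close>
  by multiples of \<open>p\<close> would overlap too little to fit into a cube of volume
  \<open>8 * L ^ 3\<close>; Cauchy--Schwarz then bounds \<open>Q * \<epsilon>\<^sup>2\<close> by
  16.\<close>

lemma popular_multiple:
  fixes A :: "z3 set" and \<epsilon> :: real and Q :: nat
  assumes \<epsilon>: "0 < \<epsilon>" and Q: "16 / \<epsilon>\<^sup>2 < real Q"
    and A: "A \<subseteq> cube x L" "\<epsilon> * real L ^ 3 \<le> real (card A)" and L: "0 < L"
    and p: "bounded_by P p" and QP: "2 * int Q * P \<le> int L" "0 \<le> P"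
  obtains q where "0 < q" "q < int Q" "\<epsilon>\<^sup>2 / 16 * real L ^ 3 \<le> real (card (returns A (zsmul q p)))"
proof (rule ccontr)
  assume no: "\<not> thesis"
  have "\<forall>q. 0 < q \<longrightarrow> q < int Q \<longrightarrow> real (card (returns A (zsmul q p))) < \<epsilon>\<^sup>2 / 16 * real L ^ 3"
    using no that by (meson not_le)
  then have small: "real (card (returns A (zsmul q p))) < \<epsilon>\<^sup>2 / 16 * real L ^ 3"
    if "0 < q" "q < int Q" for q
    using that by blast
  define l where "l = real L ^ 3"
  have l: "0 < l" using L by (simp add: l_def)
  have finA: "finite A" using A finite_cube finite_subset by blast
  define I where "I = {0..<int Q}"
  define w where "w j = zsmul j p" for j
  have pair: "real (card (returns A (w i - w j))) \<le> (if i = j then l else 0) + \<epsilon>\<^sup>2 / 16 * l"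
    if "i \<in> I" "j \<in> I" for i j
  proof (cases i j rule: linorder_cases)
    case equal
    have "card (returns A (w i - w j)) \<le> card A"
      by (rule card_mono[OF finA]) (auto simp: returns_def)
    also have "\<dots> \<le> L ^ 3" using A card_mono[OF finite_cube A(1)] by (simp add: card_cube)
    finally have "real (card (returns A (w i - w j))) \<le> l"
      unfolding l_def by (metis of_nat_le_iff of_nat_power)
    then show ?thesis using equal l by (simp add: add_increasing2)
  next
    case greater
    then show ?thesis using small[of "i - j"] that by (simp add: I_def w_def zsmul_diff l_def)
  next
    case less
    then show ?thesis using small[of "j - i"] that card_returns_uminus[of A "w i - w j"]
      by (simp add: I_def w_def zsmul_diff l_def)
  qed
  have "(real (card I) * real (card A))\<^sup>2
      \<le> real (card (cube (x - (int Q * P, int Q * P, int Q * P)) (2 * L)))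
        * (\<Sum>i\<in>I. \<Sum>j\<in>I. real (card (returns A (w i - w j))))"
  proof (rule card_returns_sum_ge)
    fix i a assume "i \<in> I" "a \<in> A"
    then have "bounded_by (int Q * P) (w i)"
      unfolding w_def by (intro bounded_by_zsmul p) (auto simp: I_def)
    then show "a + w i \<in> cube (x - (int Q * P, int Q * P, int Q * P)) (2 * L)"
      using \<open>a \<in> A\<close> A QP by (intro add_mem_cube) auto
  qed (auto simp: I_def finA)
  also have "\<dots> \<le> 8 * l * (\<Sum>i\<in>I. \<Sum>j\<in>I. (if i = j then l else 0) + \<epsilon>\<^sup>2 / 16 * l)"
    using pair by (auto simp: card_cube l_def power_mult_distrib intro!: mult_left_mono sum_mono)
  also have "(\<Sum>i\<in>I. \<Sum>j\<in>I. (if i = j then l else 0) + \<epsilon>\<^sup>2 / 16 * l) = real Q * l + (real Q)\<^sup>2 * (\<epsilon>\<^sup>2 / 16 * l)"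
    by (simp add: I_def sum.distrib power2_eq_square algebra_simps)
  finally have up: "(real (card I) * real (card A))\<^sup>2 \<le> 8 * l * (real Q * l + (real Q)\<^sup>2 * (\<epsilon>\<^sup>2 / 16 * l))" .
  have "(real Q * (\<epsilon> * l))\<^sup>2 \<le> (real (card I) * real (card A))\<^sup>2"
    using A \<epsilon> l by (intro power_mono mult_mono) (auto simp: I_def l_def)
  with up have "(real Q * l) * l * (real Q * \<epsilon>\<^sup>2) \<le> (real Q * l) * l * (8 + real Q * \<epsilon>\<^sup>2 / 2)"
    by (simp add: power2_eq_square algebra_simps)
  moreover have "16 / \<epsilon>\<^sup>2 > 0" using \<epsilon> by simp
  then have "0 < real Q" using Q by linarith
  then have "0 < (real Q * l) * l" using l by simp
  ultimately have "real Q * \<epsilon>\<^sup>2 \<le> 8 + real Q * \<epsilon>\<^sup>2 / 2" by (simp only: mult_le_cancel_left_pos)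
  moreover have "16 < real Q * \<epsilon>\<^sup>2" using Q \<epsilon> by (simp add: field_simps)
  ultimately show False by simp
qed

section \<open>Differences with a square parameter in dense sets\<close>

text \<open>The shift is a function \<open>\<tau>\<close> of \<open>q\<close> because
  \<open>q\<close> is found only within the argument, while the application must adapt the shift to
  it.\<close>

proposition square_differences:
  fixes p1 p2 p3 :: z3 and \<epsilon> :: real
  assumes \<epsilon>: "0 < \<epsilon>"
  shows "\<exists>Q N. 0 < N \<and> (\<forall>\<tau> :: int \<Rightarrow> int. (\<forall>q. N dvd \<tau> q) \<longrightarrow>
    (\<forall>B. \<epsilon> < upper_banach_density B \<longrightarrow> (\<exists>q\<in>{1..Q}. \<exists>s. \<exists>b1\<in>B. \<exists>b2\<in>B.
      b1 - b2 = zsmul q p1 + zsmul (q * (\<tau> q + s\<^sup>2)) p2 + zsmul (q * s) p3)))"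
proof -
  obtain Q :: nat where Q: "16 / \<epsilon>\<^sup>2 < real Q" using reals_Archimedean2 by blast
  \<comment> \<open>\<open>\<delta>\<close> is the density of the popular return set. In
    \<open>c\<close>, the 32 is the volume ratio 8 times the factor 4 lost in
    \<open>average_translate_ind_ge\<close>.\<close>
  define \<delta> where "\<delta> = \<epsilon>\<^sup>2 / 16"
  define c where "c = \<delta>\<^sup>2 / 32"
  have \<delta>0: "0 < \<delta>" using \<epsilon> by (simp add: \<delta>_def)
  then have "0 < c" by (simp add: c_def)
  from uniform_recurrence[OF this, where 'a = "z3 fsupp"]
  obtain N where N: "0 < N" and rec: "\<And>t. N dvd t \<Longrightarrow>
    \<exists>R>0::int. \<forall>(T :: int \<times> int \<Rightarrow> z3 fsupp \<Rightarrow> z3 fsupp) f.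
    isometric_action T \<longrightarrow> norm f \<le> 1 \<longrightarrow>
    (\<forall>m K W. 0 < m \<longrightarrow> m \<le> R \<longrightarrow> 0 \<le> K \<longrightarrow> K \<le> R \<longrightarrow> 0 \<le> W \<longrightarrow> W \<le> R \<longrightarrow>
      c \<le> inner (isometric_action.Av T {-W..W} (\<lambda>s. (0, m * s)) (isometric_action.M T m K f)) f) \<longrightarrow>
    (\<exists>s. inner (T (t + s\<^sup>2, s) f) f \<noteq> 0)"
    by blast
  show ?thesis
  proof (rule exI[of _ "int Q"], rule exI[of _ N], intro conjI allI impI)
    fix \<tau> :: "int \<Rightarrow> int" and B :: "z3 set"
    assume "\<forall>q. N dvd \<tau> q" and B: "\<epsilon> < upper_banach_density B"
    then have "\<forall>q. \<exists>R>0::int. \<forall>(T :: int \<times> int \<Rightarrow> z3 fsupp \<Rightarrow> z3 fsupp) f.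
      isometric_action T \<longrightarrow> norm f \<le> 1 \<longrightarrow>
      (\<forall>m K W. 0 < m \<longrightarrow> m \<le> R \<longrightarrow> 0 \<le> K \<longrightarrow> K \<le> R \<longrightarrow> 0 \<le> W \<longrightarrow> W \<le> R \<longrightarrow>
        c \<le> inner (isometric_action.Av T {-W..W} (\<lambda>s. (0, m * s)) (isometric_action.M T m K f)) f) \<longrightarrow>
      (\<exists>s. inner (T (\<tau> q + s\<^sup>2, s) f) f \<noteq> 0)"
      using rec by blast
    then obtain R where R0: "\<And>q. 0 < R q" and R: "\<And>q (T :: int \<times> int \<Rightarrow> z3 fsupp \<Rightarrow> z3 fsupp) f.
      isometric_action T \<Longrightarrow> norm f \<le> 1 \<Longrightarrow>
      (\<forall>m K W. 0 < m \<longrightarrow> m \<le> R q \<longrightarrow> 0 \<le> K \<longrightarrow> K \<le> R q \<longrightarrow> 0 \<le> W \<longrightarrow> W \<le> R q \<longrightarrow>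
        c \<le> inner (isometric_action.Av T {-W..W} (\<lambda>s. (0, m * s)) (isometric_action.M T m K f)) f) \<Longrightarrow>
      (\<exists>s. inner (T (\<tau> q + s\<^sup>2, s) f) f \<noteq> 0)"
      by metis
    \<comment> \<open>The cube is chosen before \<open>q\<close> is known, so the bounds for all
      candidates are added up.\<close>
    define R' where "R' = (\<Sum>q\<in>{1..int Q}. R q)"
    have R'0: "0 \<le> R'" unfolding R'_def by (rule sum_nonneg) (use R0 less_imp_le in blast)
    have R_le: "R q \<le> R'" if "0 < q" "q < int Q" for q
      unfolding R'_def by (rule member_le_sum) (use that R0 less_imp_le in \<open>auto\<close>)
    define n1 where "n1 v = \<bar>fst v\<bar> + \<bar>fst (snd v)\<bar> + \<bar>snd (snd v)\<bar>" for v :: z3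
    define P where "P = n1 p1 + n1 p2 + n1 p3"
    have P: "bounded_by P p1" "bounded_by P p2" "bounded_by P p3" "0 \<le> P"
      by (auto simp: P_def n1_def bounded_by_def)
    \<comment> \<open>Bounds every displacement \<open>\<phi> (m * k, m * s)\<close>: two
      coefficients of size at most \<open>Q * R' * R'\<close>, each multiplying a vector bounded by
      \<open>P\<close>.\<close>
    define D where "D = 2 * (int Q * (R' * R') * P)"
    have D: "0 \<le> D" using R'0 P by (simp add: D_def)
    define L where "L = nat (2 * D + 2 * int Q * P) + 1"
    have L: "0 < L" "2 * D \<le> int L" "2 * int Q * P \<le> int L"
      using D P by (auto simp: L_def)
    define l where "l = real L ^ 3"
    have l: "0 < l" using L by (simp add: l_def)
    obtain x where x: "\<epsilon> * real L ^ 3 < real (card (B \<inter> cube x L))"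
      using dense_cube[OF B L(1)] .
    define B' where "B' = B \<inter> cube x L"
    obtain q where q: "0 < q" "q < int Q" and
      big: "\<epsilon>\<^sup>2 / 16 * real L ^ 3 \<le> real (card (returns B' (zsmul q p1)))"
      using popular_multiple[OF \<epsilon> Q, of B' x L P p1] x L P by (auto simp: B'_def)
    define A where "A = returns B' (zsmul q p1)"
    have A: "\<delta> * l \<le> real (card A)" using big by (simp add: A_def \<delta>_def l_def)
    have A_sub: "A \<subseteq> cube x L" by (auto simp: A_def returns_def B'_def)
    then have finA: "finite A" using finite_cube finite_subset by blast
    have cA: "real (card A) \<le> l"
      using card_mono[OF finite_cube A_sub] by (simp add: card_cube l_def flip: of_nat_power)
    define \<phi> where "\<phi> g = zsmul (q * fst g) p2 + zsmul (q * snd g) p3" for g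
    have \<phi>_add: "\<phi> (g + h) = \<phi> g + \<phi> h" for g h
      by (simp add: \<phi>_def distrib_left zsmul_add)
    interpret isometric_action "\<lambda>g. translate (\<phi> g)"
      by (rule isometric_action_translate) (rule \<phi>_add)
    \<comment> \<open>Normalising by the volume of the cube gives norm at most 1 and correlations
      independent of \<open>L\<close>.\<close>
    define r where "r = 1 / sqrt l"
    have r: "r * r = 1 / l" using l by (simp add: r_def)
    define f where "f = r *\<^sub>R ind A"
    have "translate 0 (ind A) = ind A" by (intro fsupp_eqI) (simp add: translate.rep_eq)
    then have "inner (ind A) (ind A) = real (card (returns A 0))"
      using inner_translate_ind[OF finA, of 0] by simp
    then have "inner f f = r * r * real (card A)"
      by (simp add: f_def returns_def)
    also have "\<dots> \<le> 1" using cA l by (simp add: r)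
    finally have norm_f: "norm f \<le> 1" by (simp add: norm_eq_sqrt_inner)
    have "c \<le> inner (Av {-W..W} (\<lambda>s. (0, m * s)) (M m K f)) f"
      if m: "0 < m" "m \<le> R q" and K: "0 \<le> K" "K \<le> R q" and W: "0 \<le> W" "W \<le> R q" for m K W
    proof -
      have bound: "bounded_by D (\<phi> (m * k, m * s))" if "0 \<le> k" "k \<le> K" "0 \<le> s" "s \<le> W" for k s
      proof -
        have le: "\<bar>q * (m * j)\<bar> \<le> int Q * (R' * R')" if "0 \<le> j" "j \<le> R q" for j
          using that q m R_le[OF q] by (simp add: abs_mult) (intro mult_mono mult_nonneg_nonneg, auto)
        have "bounded_by (int Q * (R' * R') * P + int Q * (R' * R') * P) (\<phi> (m * k, m * s))"
          unfolding \<phi>_def fst_conv snd_conv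
          by (intro bounded_by_add bounded_by_zsmul P le) (use that K W in auto)
        then show ?thesis by (simp only: D_def mult_2)
      qed
      have "(\<delta>\<^sup>2 * l / 8) / 4 \<le> inner (Av {-W..W} (\<lambda>s. (0, m * s)) (M m K (ind A))) (ind A)"
      proof (rule average_translate_ind_ge[where S = "cube (x - (D, D, D)) (2 * L)"])
        show "a + \<phi> (m * k, m * s) \<in> cube (x - (D, D, D)) (2 * L)"
          if "0 \<le> k" "k \<le> K" "0 \<le> s" "s \<le> W" "a \<in> A" for k s a
          by (rule add_mem_cube[OF subsetD[OF A_sub that(5)] bound[OF that(1-4)] L(2) D])
        have "card (cube (x - (D, D, D)) (2 * L)) \<noteq> 0" using L by (simp add: card_cube)
        then show "cube (x - (D, D, D)) (2 * L) \<noteq> {}" by auto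
        have "(\<delta> * l) * (\<delta> * l) \<le> real (card A) * real (card A)"
          using A \<delta>0 l by (intro mult_mono) auto
        then show "\<delta>\<^sup>2 * l / 8 * real (card (cube (x - (D, D, D)) (2 * L))) \<le> real (card A) * real (card A)"
          by (simp add: card_cube power_mult_distrib l_def[symmetric] power2_eq_square mult_ac)
      qed (use \<phi>_add finA K W l in auto)
      then have "1 / l * ((\<delta>\<^sup>2 * l / 8) / 4)
          \<le> r * r * inner (Av {-W..W} (\<lambda>s. (0, m * s)) (M m K (ind A))) (ind A)"
        unfolding r using l by (intro mult_left_mono) auto
      also have "1 / l * ((\<delta>\<^sup>2 * l / 8) / 4) = c" using l by (simp add: c_def)
      finally show ?thesis
        by (simp add: f_def M_def linear_scale[OF linear_Av])
    qed
    then obtain s where "inner (translate (\<phi> (\<tau> q + s\<^sup>2, s)) f) f \<noteq> 0"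
      using R[OF isometric_action_axioms norm_f, of q] by blast
    then have "inner (translate (\<phi> (\<tau> q + s\<^sup>2, s)) (ind A)) (ind A) \<noteq> 0"
      by (auto simp: f_def linear_scale[OF T_linear])
    then have "returns A (\<phi> (\<tau> q + s\<^sup>2, s)) \<noteq> {}"
      by (auto simp: inner_translate_ind[OF finA])
    then obtain y where y: "y \<in> A" "y + \<phi> (\<tau> q + s\<^sup>2, s) \<in> A"
      by (auto simp: returns_def)
    \<comment> \<open>Points of \<open>A\<close> remain in \<open>B\<close> after adding
      \<open>q\<close> times \<open>p1\<close>, which supplies the first summand of the
      difference.\<close>
    then have "y \<in> B" "y + \<phi> (\<tau> q + s\<^sup>2, s) + zsmul q p1 \<in> B"
      by (auto simp: A_def returns_def B'_def)
    moreover have "y + \<phi> (\<tau> q + s\<^sup>2, s) + zsmul q p1 - y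
        = zsmul q p1 + zsmul (q * (\<tau> q + s\<^sup>2)) p2 + zsmul (q * s) p3"
      by (simp add: \<phi>_def)
    moreover have "q \<in> {1..int Q}" using q by auto
    ultimately show "\<exists>q\<in>{1..int Q}. \<exists>s. \<exists>b1\<in>B. \<exists>b2\<in>B.
        b1 - b2 = zsmul q p1 + zsmul (q * (\<tau> q + s\<^sup>2)) p2 + zsmul (q * s) p3"
      by blast
  qed (rule N)
qed

section \<open>From square differences to values of the forms\<close>

text \<open>The quadratic terms in \<open>s\<close> cancel in \<open>F\<close>, which then depends on \<open>q\<close> and \<open>t\<close> only.\<close>

lemma multiples_in_image:
  fixes F :: "z3 \<Rightarrow> int" and \<epsilon> :: real
  assumes \<epsilon>: "0 < \<epsilon>" and a: "a dvd 4"
    and F: "\<And>q t s. F (zsmul q p1 + zsmul (q * (t + s\<^sup>2)) p2 + zsmul (q * s) p3) = a * q\<^sup>2 * t"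
  shows "\<exists>k>0. \<forall>B. \<epsilon> < upper_banach_density B \<longrightarrow> {k * n | n. True} \<subseteq> F ` diffset B"
proof -
  from square_differences[OF \<epsilon>, of p1 p2 p3] obtain Q N where N: "0 < N"
    and diff: "\<And>(\<tau> :: int \<Rightarrow> int) B. \<forall>q. N dvd \<tau> q \<Longrightarrow> \<epsilon> < upper_banach_density B \<Longrightarrow>
      \<exists>q\<in>{1..Q}. \<exists>s. \<exists>b1\<in>B. \<exists>b2\<in>B.
        b1 - b2 = zsmul q p1 + zsmul (q * (\<tau> q + s\<^sup>2)) p2 + zsmul (q * s) p3"
    by blast
  obtain a' where a': "4 = a * a'" using a by (elim dvdE)
  \<comment> \<open>The factorial is divisible by every admissible \<open>q\<close>, and 4 by the
    leading coefficient \<open>a\<close>.\<close>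
  define k where "k = 4 * N * (fact (nat Q))\<^sup>2"
  show ?thesis
  proof (intro exI[of _ k] conjI allI impI subsetI)
    show "0 < k" using N by (simp add: k_def)
    fix B v assume B: "\<epsilon> < upper_banach_density B" and "v \<in> {k * n | n. True}"
    then obtain n where n: "v = k * n" by blast
    \<comment> \<open>Chosen so that \<open>a * q\<^sup>2 * \<tau> q\<close> equals
      \<open>k * n\<close> for whichever \<open>q\<close> in the range turns up, while
      \<open>N\<close> divides every value.\<close>
    define \<tau> where "\<tau> q = N * a' * (fact (nat Q) div q)\<^sup>2 * n" for q
    obtain q s b1 b2 where q: "q \<in> {1..Q}" and b: "b1 \<in> B" "b2 \<in> B"
      "b1 - b2 = zsmul q p1 + zsmul (q * (\<tau> q + s\<^sup>2)) p2 + zsmul (q * s) p3"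
      using diff[of \<tau>, OF _ B] by (auto simp: \<tau>_def mult.assoc)
    have "nat q dvd fact (nat Q)" using q by (intro dvd_fact) auto
    then have "q dvd fact (nat Q)"
      using q by (metis atLeastAtMost_iff int_nat_eq int_dvd_int_iff of_nat_fact order_trans zero_le_one)
    then have qf: "q * (fact (nat Q) div q) = fact (nat Q)" by simp
    have "F (b1 - b2) = a * q\<^sup>2 * \<tau> q" unfolding b by (rule F)
    also have "\<dots> = (a * a') * N * (q * (fact (nat Q) div q))\<^sup>2 * n"
      unfolding \<tau>_def power_mult_distrib by (simp only: mult_ac)
    also have "\<dots> = v" unfolding qf by (simp add: n k_def flip: a')
    finally have "F (b1 - b2) = v" .
    moreover have "vdiff b1 b2 \<in> diffset B" unfolding diffset_def using b(1,2) by blast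
    then have "b1 - b2 \<in> diffset B" by (cases b1; cases b2) (simp add: vdiff_def)
    ultimately show "v \<in> F ` diffset B" by blast
  qed
qed

theorem theorem1p3:
  fixes F :: "z3 \<Rightarrow> int"
  assumes "F = (\<lambda>(x, y, z). x * y - z ^ 2) \<or> F = (\<lambda>(x, y, z). x ^ 2 + y ^ 2 - z ^ 2)"
  shows "\<forall>\<epsilon>::real. \<epsilon> > 0 \<longrightarrow> (\<exists>k::int. k > 0 \<and>
           (\<forall>B::z3 set. upper_banach_density B > \<epsilon> \<longrightarrow>
              {k * n | n. True} \<subseteq> F ` diffset B))"
  using assms
proof (elim disjE; intro allI impI)
  fix \<epsilon> :: real
  assume "F = (\<lambda>(x, y, z). x * y - z ^ 2)" and "0 < \<epsilon>"
  then show "\<exists>k>0. \<forall>B. \<epsilon> < upper_banach_density B \<longrightarrow> {k * n | n. True} \<subseteq> F ` diffset B"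
    by (intro multiples_in_image[where a = 1 and ?p1.0 = "(1, 0, 0)" and ?p2.0 = "(0, 1, 0)" and ?p3.0 = "(0, 0, 1)"])
      (auto simp: zsmul_def power2_eq_square algebra_simps)
next
  fix \<epsilon> :: real
  assume "F = (\<lambda>(x, y, z). x ^ 2 + y ^ 2 - z ^ 2)" and "0 < \<epsilon>"
  \<comment> \<open>The first two vectors are isotropic and the third is orthogonal to both; with
    coefficients \<open>u\<close>, \<open>v\<close>, \<open>w\<close> the form becomes
    \<open>- 4 * (u * v - w\<^sup>2)\<close>.\<close>
  then show "\<exists>k>0. \<forall>B. \<epsilon> < upper_banach_density B \<longrightarrow> {k * n | n. True} \<subseteq> F ` diffset B"
    by (intro multiples_in_image[where a = "- 4" and ?p1.0 = "(1, 0, - 1)" and ?p2.0 = "(- 1, 0, - 1)" and ?p3.0 = "(0, 2, 0)"])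
      (auto simp: zsmul_def power2_eq_square algebra_simps)
qed

end
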